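(* Let $r,s\ge1$ be integers and let $G=\mathrm{GL}_n$, where $n\ge r+s$. Then for $a_1,\dots,a_r,b_1,\dots,b_s\in\mathbb Z_{\ge0}$, the dimension $$\dim\mathrm{Hom}_G\left(\bigotimes_{i=1}^r F_n^{(a_i)},\ \bigotimes_{j=1}^s F_n^{(b_j)}\right)$$ is equal to the number of $r\times s$ contingency tables with margins $(a_1,\dots,a_r)$ and $(b_1,\dots,b_s)$.
   Context: $\mathrm{GL}_n=\mathrm{GL}(n,\mathbb C)$. For $a\in\mathbb Z_{\ge0}$, $F_n^{(a)}$ denotes the irreducible polynomial representation of $\mathrm{GL}_n$ with highest weight $(a,0,\dots,0)$ (with respect to the upper triangular Borel subgroup and diagonal torus); $F_n^{(0)}$ is the trivial representation. An $r\times s$ contingency table with margins $(a_1,\dots,a_r)$ and $(b_1,\dots,b_s)$ is an $r\times s$ matrix of nonnegative integers whose $i$-th row sum is $a_i$ for each $i$ and whose $j$-th column sum is $b_j$ for each $j$. *)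

theory Defs
  imports "Jordan_Normal_Form.VS_Connect"
begin

abbreviation GL :: "nat \<Rightarrow> complex mat monoid" where
  "GL n \<equiv> units_of (ring_mat TYPE(complex) n ())"

text \<open>Finite-dimensional representations are taken on coordinate spaces: a representation of
  \<open>GL\<^sub>n\<close> of degree \<open>d\<close> is a homomorphism into \<open>GL\<^sub>d\<close>, acting on \<^term>\<open>carrier_vec d\<close>.\<close>

definition GL_rep :: "nat \<Rightarrow> nat \<Rightarrow> (complex mat \<Rightarrow> complex mat) \<Rightarrow> bool" where
  "GL_rep n d \<rho> \<longleftrightarrow> \<rho> \<in> hom (GL n) (GL d)"

text \<open>A monomial in the \<open>n\<^sup>2\<close> matrix entries is given by its exponents \<open>m i j\<close>.\<close>

definition polynomial_function_on_GL :: "nat \<Rightarrow> (complex mat \<Rightarrow> complex) \<Rightarrow> bool" where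
  "polynomial_function_on_GL n f \<longleftrightarrow>
    (\<exists>(M :: (nat \<Rightarrow> nat \<Rightarrow> nat) set) c. finite M \<and>
      (\<forall>g\<in>carrier (GL n). f g = (\<Sum>m\<in>M. c m * (\<Prod>i<n. \<Prod>j<n. (g $$ (i, j)) ^ m i j))))"

definition polynomial_rep ::
  "nat \<Rightarrow> nat \<Rightarrow> (complex mat \<Rightarrow> complex mat) \<Rightarrow> bool" where
  "polynomial_rep n d \<rho> \<longleftrightarrow> GL_rep n d \<rho> \<and>
    (\<forall>k<d. \<forall>l<d. polynomial_function_on_GL n (\<lambda>g. \<rho> g $$ (k, l)))"

definition irreducible_rep ::
  "nat \<Rightarrow> nat \<Rightarrow> (complex mat \<Rightarrow> complex mat) \<Rightarrow> bool" where
  "irreducible_rep n d \<rho> \<longleftrightarrow> GL_rep n d \<rho> \<and> d > 0 \<and>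
    (\<forall>W. subspace class_ring W (module_vec TYPE(complex) d) \<and>
         (\<forall>g\<in>carrier (GL n). \<forall>w\<in>W. \<rho> g *\<^sub>v w \<in> W)
      \<longrightarrow> W = {0\<^sub>v d} \<or> W = carrier_vec d)"

text \<open>A highest weight vector of weight \<open>w\<close> spans a line on which the Borel subgroup of upper
  triangular matrices acts by the character \<open>b \<mapsto> \<Prod>i<n. b\<^sub>i\<^sub>i powi w i\<close>: the diagonal torus acts
  with weight \<open>w\<close> and the unipotent radical acts trivially. Indices start at 0.\<close>

definition highest_weight ::
  "nat \<Rightarrow> nat \<Rightarrow> (complex mat \<Rightarrow> complex mat) \<Rightarrow> (nat \<Rightarrow> int) \<Rightarrow> bool" where
  "highest_weight n d \<rho> w \<longleftrightarrow>
    (\<exists>v\<in>carrier_vec d. v \<noteq> 0\<^sub>v d \<and>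
      (\<forall>b\<in>carrier (GL n). upper_triangular b \<longrightarrow>
        \<rho> b *\<^sub>v v = (\<Prod>i<n. (b $$ (i, i)) powi w i) \<cdot>\<^sub>v v))"

text \<open>\<open>F_rep n a d \<rho>\<close>: the representation \<open>\<rho>\<close> of degree \<open>d\<close> is a model of \<open>F\<^sub>n\<close> with highest
  weight \<open>(a, 0, \<dots>, 0)\<close>. The model is unique up to isomorphism only.\<close>

definition F_rep :: "nat \<Rightarrow> nat \<Rightarrow> nat \<Rightarrow> (complex mat \<Rightarrow> complex mat) \<Rightarrow> bool" where
  "F_rep n a d \<rho> \<longleftrightarrow> irreducible_rep n d \<rho> \<and> polynomial_rep n d \<rho> \<and>
    highest_weight n d \<rho> (\<lambda>i. if i = 0 then int a else 0)"

text \<open>The Kronecker product: the matrix of a tensor product of linear maps with respect to the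
  lexicographically ordered basis \<open>e\<^sub>i \<otimes> e\<^sub>k\<close>.\<close>

definition kronecker :: "complex mat \<Rightarrow> complex mat \<Rightarrow> complex mat" where
  "kronecker A B = mat (dim_row A * dim_row B) (dim_col A * dim_col B)
    (\<lambda>(i, j). A $$ (i div dim_row B, j div dim_col B) * B $$ (i mod dim_row B, j mod dim_col B))"

definition tensor_rep ::
  "nat \<Rightarrow> (nat \<Rightarrow> complex mat \<Rightarrow> complex mat) \<Rightarrow> complex mat \<Rightarrow> complex mat" where
  "tensor_rep r \<rho> g = foldr kronecker (map (\<lambda>i. \<rho> i g) [0..<r]) (1\<^sub>m 1)"

definition Hom_GL :: "nat \<Rightarrow> nat \<Rightarrow> (complex mat \<Rightarrow> complex mat) \<Rightarrow>
    nat \<Rightarrow> (complex mat \<Rightarrow> complex mat) \<Rightarrow> complex mat set" where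
  "Hom_GL n d \<rho> e \<sigma> =
    {T \<in> carrier_mat e d. \<forall>g\<in>carrier (GL n). T * \<rho> g = \<sigma> g * T}"

lemma subspace_Hom_GL:
  assumes "GL_rep n d \<rho>" and "GL_rep n e \<sigma>"
  shows "subspace class_ring (Hom_GL n d \<rho> e \<sigma>) (module_mat TYPE(complex) e d)"
proof -
  have c: "\<rho> g \<in> carrier_mat d d" "\<sigma> g \<in> carrier_mat e e" if "g \<in> carrier (GL n)" for g
    using assms that unfolding GL_rep_def hom_def
    by (auto simp: units_of_def Units_def ring_mat_simps Pi_def)
  interpret vectorspace class_ring "module_mat TYPE(complex) e d" by (rule matrix_vs)
  show ?thesis
    unfolding subspace_def
  proof (intro conjI vectorspace_axioms, unfold_locales, goal_cases)
    case 1 show ?case by (auto simp: Hom_GL_def module_mat_simps)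
  next
    case (2 v w)
    have "(v + w) * \<rho> g = \<sigma> g * (v + w)" if g: "g \<in> carrier (GL n)" for g
      using 2 g c[OF g] add_mult_distrib_mat[of v e d w "\<rho> g" d]
        mult_add_distrib_mat[of "\<sigma> g" e e v d w]
      by (auto simp: Hom_GL_def)
    with 2 show ?case by (auto simp: Hom_GL_def module_mat_simps)
  next
    case 3
    have "0\<^sub>m e d * \<rho> g = \<sigma> g * 0\<^sub>m e d" if g: "g \<in> carrier (GL n)" for g
      using c[OF g] by auto
    then show ?case by (auto simp: Hom_GL_def module_mat_simps)
  next
    case (4 k v)
    have "(k \<cdot>\<^sub>m v) * \<rho> g = \<sigma> g * (k \<cdot>\<^sub>m v)" if g: "g \<in> carrier (GL n)" for g
      using 4 g c[OF g] mult_smult_distrib[of "\<sigma> g" e e v d k]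
        mult_smult_assoc_mat[of v e d "\<rho> g" d k]
      by (auto simp: Hom_GL_def)
    with 4 show ?case by (auto simp: Hom_GL_def module_mat_simps)
  qed
qed

definition dim_Hom_GL :: "nat \<Rightarrow> nat \<Rightarrow> (complex mat \<Rightarrow> complex mat) \<Rightarrow>
    nat \<Rightarrow> (complex mat \<Rightarrow> complex mat) \<Rightarrow> nat" where
  "dim_Hom_GL n d \<rho> e \<sigma> = vectorspace.dim class_ring
    ((module_mat TYPE(complex) e d)\<lparr>carrier := Hom_GL n d \<rho> e \<sigma>\<rparr>)"

definition contingency_tables ::
  "nat \<Rightarrow> nat \<Rightarrow> (nat \<Rightarrow> nat) \<Rightarrow> (nat \<Rightarrow> nat) \<Rightarrow> nat mat set" where
  "contingency_tables r s a b =
    {C \<in> carrier_mat r s. (\<forall>i<r. (\<Sum>j<s. C $$ (i, j)) = a i) \<and>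
                          (\<forall>j<s. (\<Sum>i<r. C $$ (i, j)) = b j)}"

end

theory Submission
  imports Defs "Jordan_Normal_Form.Char_Poly" "Jordan_Normal_Form.Gauss_Jordan_Elimination"
begin

text \<open>The representation with highest weight \<open>(a, 0, \<dots>, 0)\<close> is the symmetric power \<open>Sym\<^sup>a\<close> of the
  standard representation, so the homomorphisms in question go from
  \<open>V = Sym\<^bsup>a 0\<^esup> \<otimes> \<dots> \<otimes> Sym\<^bsup>a (r-1)\<^esup>\<close> to \<open>W = Sym\<^bsup>b 0\<^esup> \<otimes> \<dots> \<otimes> Sym\<^bsup>b (s-1)\<^esup>\<close>. For \<open>n \<ge> r\<close> the vector
  \<open>v = e\<^sub>0\<^bsup>a 0\<^esup> \<otimes> \<dots> \<otimes> e\<^bsub>r-1\<^esub>\<^bsup>a (r-1)\<^esup>\<close> generates \<open>V\<close>, and \<open>V\<close> is universal among the polynomial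
  representations with a vector of the weight \<open>(a\<^sub>0, \<dots>, a\<^bsub>r-1\<^esub>, 0, \<dots>, 0)\<close> of \<open>v\<close>: sending \<open>T\<close> to \<open>T v\<close>
  identifies \<open>Hom(V, W)\<close> with the space of vectors of this weight in \<open>W\<close>. The space \<open>W\<close> has a basis
  of tensor products of monomials. Such a product is recorded by the matrix of its exponents, in which
  column \<open>j\<close> has sum \<open>b j\<close>, and its weight is the vector of row sums. The basis vectors of the given
  weight are therefore the contingency tables.

  The universal property has an elementary reason (\<open>polynomial_of_right_weight\<close>). If \<open>w\<close> has the weight
  of \<open>v\<close>, then \<open>g \<mapsto> g w\<close> is polynomial in the entries of \<open>g\<close> and of degree zero in the last \<open>n - r\<close>
  columns of \<open>g\<close>, so it does not depend on them, and it is homogeneous of degree \<open>a i\<close> in column \<open>i\<close>. For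
  \<open>w = v\<close> the coordinates of \<open>g v\<close> are exactly the monomials with these degrees, so \<open>g w\<close> is a linear
  function of \<open>g v\<close>.

  The same observation with \<open>r = 1\<close> shows that an irreducible polynomial representation with highest
  weight \<open>(a, 0, \<dots>, 0)\<close> is a symmetric power (\<open>F_rep_monomial_model\<close>). What is used of this
  identification is kept in the notion of a \<open>monomial_model\<close>, which passes to tensor products
  (\<open>tensor_rep_monomial_model\<close>); the dimension is computed for any two representations with such models
  (\<open>dim_Hom_GL_monomial_models\<close>).\<close>

section \<open>Characters\<close>

text \<open>Take an element of the subspace \<open>Z\<close> with \<open>y \<gamma> \<noteq> 0\<close> and as few other nonzero coordinates as
  possible. If \<open>y l \<noteq> 0\<close> for some \<open>l \<noteq> \<gamma>\<close>, a point separating the two characters yields the element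
  \<open>(\<chi> k t - \<chi> l t) * y k\<close>, which loses the coordinate \<open>l\<close> but keeps \<open>\<gamma>\<close>.\<close>

lemma indicator_from_characters:
  fixes \<chi> :: "'k \<Rightarrow> 't \<Rightarrow> complex"
  assumes fin: "finite K" and sep: "\<And>k l. k \<in> K \<Longrightarrow> l \<in> K \<Longrightarrow> k \<noteq> l \<Longrightarrow> \<exists>t\<in>S. \<chi> k t \<noteq> \<chi> l t"
    and mult: "\<And>y t. Z y \<Longrightarrow> t \<in> S \<Longrightarrow> Z (\<lambda>k. \<chi> k t * y k)"
    and lin: "\<And>y y' c. Z y \<Longrightarrow> Z y' \<Longrightarrow> Z (\<lambda>k. y k + c * y' k)"
    and y: "Z y" "\<gamma> \<in> K" "y \<gamma> \<noteq> 0"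
  shows "\<exists>y'. Z y' \<and> y' \<gamma> = 1 \<and> (\<forall>k\<in>K - {\<gamma>}. y' k = 0)"
  using y
proof (induction "card {k\<in>K - {\<gamma>}. y k \<noteq> 0}" arbitrary: y rule: less_induct)
  case less
  show ?case
  proof (cases "\<exists>k\<in>K - {\<gamma>}. y k \<noteq> 0")
    case False
    have "Z (\<lambda>k. y k + (1 / y \<gamma> - 1) * y k)" using less.prems(1) by (intro lin)
    moreover have "y \<gamma> + (1 / y \<gamma> - 1) * y \<gamma> = 1" using less.prems by (simp add: field_simps)
    ultimately show ?thesis using False by (intro exI[of _ "\<lambda>k. y k + (1 / y \<gamma> - 1) * y k"]) auto
  next
    case True
    then obtain l where l: "l \<in> K" "l \<noteq> \<gamma>" "y l \<noteq> 0" by auto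
    obtain t where t: "t \<in> S" "\<chi> \<gamma> t \<noteq> \<chi> l t" using sep[of \<gamma> l] l less.prems by auto
    let ?z = "\<lambda>k. \<chi> k t * y k + (- \<chi> l t) * y k"
    have z: "?z = (\<lambda>k. (\<chi> k t - \<chi> l t) * y k)" by (auto simp: algebra_simps)
    have "{k\<in>K - {\<gamma>}. ?z k \<noteq> 0} \<subset> {k\<in>K - {\<gamma>}. y k \<noteq> 0}"
      unfolding z using l by auto
    then have "card {k\<in>K - {\<gamma>}. ?z k \<noteq> 0} < card {k\<in>K - {\<gamma>}. y k \<noteq> 0}"
      using fin by (intro psubset_card_mono) auto
    moreover have "Z ?z" by (intro lin mult less.prems t)
    moreover have "?z \<gamma> \<noteq> 0" using t less.prems unfolding z by auto
    ultimately show ?thesis using less.hyps[of ?z] less.prems by blast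
  qed
qed

text \<open>The coefficient families of linear relations between the characters form a subspace as in
  \<open>indicator_from_characters\<close>, because translating a relation by \<open>t\<close> multiplies its coefficients by
  \<open>\<chi> k t\<close>. A nontrivial relation would therefore produce the relation \<open>\<chi> k = 0\<close>, which fails at the
  neutral element.\<close>

lemma independence_of_characters:
  fixes \<chi> :: "'k \<Rightarrow> 't \<Rightarrow> complex"
  assumes fin: "finite K" and sep: "\<And>k l. k \<in> K \<Longrightarrow> l \<in> K \<Longrightarrow> k \<noteq> l \<Longrightarrow> \<exists>t\<in>S. \<chi> k t \<noteq> \<chi> l t"
    and one: "e \<in> S" "\<And>k. \<chi> k e = 1"
    and mult: "\<And>x y. x \<in> S \<Longrightarrow> y \<in> S \<Longrightarrow> op x y \<in> S" "\<And>k x y. \<chi> k (op x y) = \<chi> k x * \<chi> k y"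
    and zero: "\<And>x. x \<in> S \<Longrightarrow> (\<Sum>k\<in>K. z k * \<chi> k x) = 0"
    and k: "k \<in> K"
  shows "z k = 0"
proof (rule ccontr)
  assume nz: "z k \<noteq> 0"
  have "\<exists>y'. (\<forall>x\<in>S. (\<Sum>k\<in>K. y' k * \<chi> k x) = 0) \<and> y' k = 1 \<and> (\<forall>l\<in>K - {k}. y' l = 0)"
  proof (rule indicator_from_characters[where S = S and \<chi> = \<chi> and y = z])
    show "\<forall>x\<in>S. (\<Sum>k\<in>K. (\<chi> k t * y k) * \<chi> k x) = 0"
      if "\<forall>x\<in>S. (\<Sum>k\<in>K. y k * \<chi> k x) = 0" "t \<in> S" for y t
    proof
      fix x assume "x \<in> S"
      then have "(\<Sum>k\<in>K. y k * \<chi> k (op t x)) = 0" using that mult(1) by blast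
      then show "(\<Sum>k\<in>K. (\<chi> k t * y k) * \<chi> k x) = 0" by (simp add: mult ac_simps)
    qed
    show "\<forall>x\<in>S. (\<Sum>k\<in>K. (y k + c * y' k) * \<chi> k x) = 0"
      if "\<forall>x\<in>S. (\<Sum>k\<in>K. y k * \<chi> k x) = 0" "\<forall>x\<in>S. (\<Sum>k\<in>K. y' k * \<chi> k x) = 0" for y y' c
    proof
      fix x assume "x \<in> S"
      have "(\<Sum>k\<in>K. (y k + c * y' k) * \<chi> k x)
          = (\<Sum>k\<in>K. y k * \<chi> k x) + c * (\<Sum>k\<in>K. y' k * \<chi> k x)"
        by (simp add: sum.distrib sum_distrib_left algebra_simps)
      with that \<open>x \<in> S\<close> show "(\<Sum>k\<in>K. (y k + c * y' k) * \<chi> k x) = 0" by simp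
    qed
  qed (use fin sep k nz zero in auto)
  then obtain y' where y': "\<forall>x\<in>S. (\<Sum>k\<in>K. y' k * \<chi> k x) = 0" "y' k = 1" "\<forall>l\<in>K - {k}. y' l = 0"
    by auto
  have "(\<Sum>l\<in>K. y' l * \<chi> l e) = (\<Sum>l\<in>K. if l = k then 1 else 0)"
    using y' one by (intro sum.cong) auto
  also have "\<dots> = 1" using fin k by simp
  finally show False using bspec[OF y'(1) one(1)] by simp
qed

section \<open>Monomials in the entries of a matrix\<close>

definition monomial :: "nat \<Rightarrow> nat \<Rightarrow> (nat \<Rightarrow> nat \<Rightarrow> nat) \<Rightarrow> (nat \<Rightarrow> nat \<Rightarrow> complex) \<Rightarrow> complex" where
  "monomial n r m X = (\<Prod>p<n. \<Prod>i<r. X p i ^ m p i)"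

text \<open>The exponents of the monomials in an \<open>n\<close> by \<open>r\<close> matrix that are homogeneous of degree \<open>a i\<close> in
  column \<open>i\<close>. Exponents vanish outside the matrix, so that distinct exponents are distinct monomials.\<close>

definition exponents :: "nat \<Rightarrow> nat \<Rightarrow> (nat \<Rightarrow> nat) \<Rightarrow> (nat \<Rightarrow> nat \<Rightarrow> nat) set" where
  "exponents n r a = {m. (\<forall>i<r. (\<Sum>p<n. m p i) = a i) \<and> (\<forall>p i. \<not> (p < n \<and> i < r) \<longrightarrow> m p i = 0)}"

lemma finite_exponents: "finite (exponents n r a)"
proof -
  let ?B = "\<Sum>i<r. a i"
  let ?F = "{f. \<forall>x. (x \<in> {..<n} \<times> {..<r} \<longrightarrow> f x \<in> {..?B}) \<and> (x \<notin> {..<n} \<times> {..<r} \<longrightarrow> f x = 0)}"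
  have "finite ?F" by (intro finite_set_of_finite_funs) auto
  moreover have "exponents n r a \<subseteq> curry ` ?F"
  proof
    fix m assume m: "m \<in> exponents n r a"
    have "m p i \<le> ?B" if "p < n" "i < r" for p i
    proof -
      have "m p i \<le> (\<Sum>p<n. m p i)" using that by (intro member_le_sum) auto
      also have "\<dots> = a i" using m that by (auto simp: exponents_def)
      also have "\<dots> \<le> ?B" using that by (intro member_le_sum) auto
      finally show ?thesis .
    qed
    then have "case_prod m \<in> ?F" using m by (auto simp: exponents_def)
    then show "m \<in> curry ` ?F" by (intro image_eqI[of _ _ "case_prod m"]) auto
  qed
  ultimately show ?thesis using finite_surj by blast
qed

lemma monomial_one [simp]: "monomial n r m (\<lambda>p i. 1) = 1"
  by (simp add: monomial_def)

lemma monomial_mult: "monomial n r m (\<lambda>p i. X p i * Y p i) = monomial n r m X * monomial n r m Y"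
  by (simp add: monomial_def power_mult_distrib prod.distrib)

lemma monomial_cong:
  "(\<And>p i. p < n \<Longrightarrow> i < r \<Longrightarrow> X p i = Y p i) \<Longrightarrow> monomial n r m X = monomial n r m Y"
  unfolding monomial_def by (intro prod.cong) auto

lemma monomial_scale_rows:
  "monomial n r m (\<lambda>p i. t p * X p i) = (\<Prod>p<n. t p ^ (\<Sum>i<r. m p i)) * monomial n r m X"
  by (simp add: monomial_def power_mult_distrib prod.distrib power_sum)

lemma monomial_scale_columns:
  "monomial n r m (\<lambda>p i. t i * X p i) = (\<Prod>i<r. t i ^ (\<Sum>p<n. m p i)) * monomial n r m X"
  by (simp add: monomial_def power_mult_distrib prod.distrib power_sum prod.swap[of _ "{..<n}"])

lemma monomial_separates:
  assumes "m \<in> exponents n r a" "m' \<in> exponents n r b" "m \<noteq> m'"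
  shows "\<exists>X. (\<forall>p i. X p i \<noteq> 0) \<and> monomial n r m X \<noteq> monomial n r m' X"
proof -
  obtain p i where pi: "m p i \<noteq> m' p i" using assms(3) by (metis ext)
  then have lt: "p < n" "i < r" using assms by (auto simp: exponents_def)
  let ?X = "\<lambda>q j. if q = p \<and> j = i then 2 else 1 :: complex"
  have eval: "monomial n r l ?X = 2 ^ l p i" for l
  proof -
    have "(\<Prod>j<r. ?X q j ^ l q j) = (if q = p then 2 ^ l p i else 1)" for q
    proof (cases "q = p")
      case True
      have "(\<Prod>j<r. ?X q j ^ l q j) = (\<Prod>j<r. if j = i then 2 ^ l p i else 1)"
        using True by (intro prod.cong) auto
      then show ?thesis using True lt by simp
    qed simp
    then show ?thesis using lt by (simp add: monomial_def)
  qed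
  have "(2::complex) ^ m p i \<noteq> 2 ^ m' p i"
  proof
    assume "(2::complex) ^ m p i = 2 ^ m' p i"
    then have "norm ((2::complex) ^ m p i) = norm ((2::complex) ^ m' p i)" by simp
    then have "(2::real) ^ m p i = 2 ^ m' p i" by (simp add: norm_power)
    then show False using pi by simp
  qed
  then show ?thesis using eval by (intro exI[of _ ?X]) auto
qed

text \<open>Monomials are characters of the monoid of matrices without zero entries under entrywise
  multiplication.\<close>

lemma monomials_independent:
  assumes "\<And>X. (\<forall>p i. X p i \<noteq> 0) \<Longrightarrow> (\<Sum>m\<in>exponents n r a. z m * monomial n r m X) = 0"
    and "m \<in> exponents n r a"
  shows "z m = 0"
proof (rule independence_of_characters[where \<chi> = "monomial n r" and S = "{X. \<forall>p i. X p i \<noteq> 0}"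
      and e = "\<lambda>p i. 1" and op = "\<lambda>X Y p i. X p i * Y p i" and z = z])
  show "\<exists>t\<in>{X. \<forall>p i. X p i \<noteq> 0}. monomial n r k t \<noteq> monomial n r l t"
    if "k \<in> exponents n r a" "l \<in> exponents n r a" "k \<noteq> l" for k l
    using monomial_separates[OF that] by blast
qed (use assms in \<open>auto simp: finite_exponents monomial_mult\<close>)

section \<open>The general linear group\<close>

lemma carrier_GL:
  "carrier (GL n) = {g \<in> carrier_mat n n. \<exists>h\<in>carrier_mat n n. h * g = 1\<^sub>m n \<and> g * h = 1\<^sub>m n}"
  by (auto simp: units_of_def Units_def ring_mat_simps)

lemma GL_carrier_mat: "g \<in> carrier (GL n) \<Longrightarrow> g \<in> carrier_mat n n"
  by (simp add: carrier_GL)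

lemma mult_GL [simp]: "g \<otimes>\<^bsub>GL n\<^esub> h = g * h"
  by (simp add: units_of_def ring_mat_simps)

lemma det_nonzero_GL:
  assumes "g \<in> carrier_mat n n" "det g \<noteq> 0"
  shows "g \<in> carrier (GL n)"
  using det_non_zero_imp_unit[OF assms, of "()"] by (simp add: units_of_def)

lemma GL_mult_closed:
  assumes "g \<in> carrier (GL n)" "h \<in> carrier (GL n)"
  shows "g * h \<in> carrier (GL n)"
proof -
  interpret ring "ring_mat TYPE(complex) n ()" by (rule ring_mat)
  have "g * h \<in> Units (ring_mat TYPE(complex) n ())"
    using Units_m_closed[of g h] assms by (simp add: units_of_def ring_mat_simps)
  then show ?thesis by (simp add: units_of_def)
qed

lemma one_GL: "1\<^sub>m n \<in> carrier (GL n)"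
  by (intro det_nonzero_GL) auto

text \<open>The columns are functions and not a matrix, so that blocks of columns can be taken apart and
  put together without carriers.\<close>

definition act :: "nat \<Rightarrow> complex mat \<Rightarrow> (nat \<Rightarrow> nat \<Rightarrow> complex) \<Rightarrow> nat \<Rightarrow> nat \<Rightarrow> complex" where
  "act n g X p i = (\<Sum>q<n. g $$ (p, q) * X q i)"

abbreviation entries :: "complex mat \<Rightarrow> nat \<Rightarrow> nat \<Rightarrow> complex" where
  "entries g \<equiv> \<lambda>p i. g $$ (p, i)"

lemma index_mult_sum:
  assumes "g \<in> carrier_mat m n" "h \<in> carrier_mat n k" "p < m" "i < k"
  shows "(g * h) $$ (p, i) = (\<Sum>q<n. g $$ (p, q) * h $$ (q, i))"
  using assms by (auto simp: scalar_prod_def atLeast0LessThan intro!: sum.cong)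

definition diag :: "nat \<Rightarrow> (nat \<Rightarrow> complex) \<Rightarrow> complex mat" where
  "diag n t = mat n n (\<lambda>(p, q). if p = q then t p else 0)"

lemma diag_carrier [simp]: "diag n t \<in> carrier_mat n n"
  by (simp add: diag_def)

lemma diag_upper_triangular: "upper_triangular (diag n t)"
  by (auto simp: diag_def upper_triangular_def)

lemma diag_GL:
  assumes "\<forall>p<n. t p \<noteq> 0"
  shows "diag n t \<in> carrier (GL n)"
proof (rule det_nonzero_GL)
  have "det (diag n t) = prod_list (diag_mat (diag n t))"
    by (rule det_upper_triangular[OF diag_upper_triangular diag_carrier])
  also have "\<dots> = (\<Prod>p<n. t p)"
    by (simp add: diag_mat_def prod.list_conv_set_nth diag_def atLeast0LessThan)
  finally show "det (diag n t) \<noteq> 0" using assms by simp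
qed simp

lemma mult_diag_index:
  assumes "g \<in> carrier_mat m n" "p < m" "i < n"
  shows "(g * diag n t) $$ (p, i) = t i * g $$ (p, i)"
proof -
  have "(g * diag n t) $$ (p, i) = (\<Sum>q<n. g $$ (p, q) * (if q = i then t q else 0))"
    using assms by (subst index_mult_sum[of _ m n _ n]) (auto simp: diag_def intro!: sum.cong)
  also have "\<dots> = (\<Sum>q<n. if q = i then t i * g $$ (p, i) else 0)" by (intro sum.cong) auto
  finally show ?thesis using assms by simp
qed

lemma act_diag: "p < n \<Longrightarrow> act n (diag n t) X p i = t p * X p i"
proof -
  assume p: "p < n"
  have "act n (diag n t) X p i = (\<Sum>q<n. if q = p then t p * X p i else 0)"
    unfolding act_def using p by (intro sum.cong) (auto simp: diag_def)
  then show ?thesis using p by simp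
qed

section \<open>Polynomial functions on the general linear group\<close>

text \<open>A list of terms, in which monomials may be repeated, makes closure under sums and products
  immediate.\<close>

definition poly_fun :: "nat \<Rightarrow> (complex mat \<Rightarrow> complex) \<Rightarrow> bool" where
  "poly_fun n f \<longleftrightarrow> (\<exists>L. \<forall>g\<in>carrier (GL n). f g = (\<Sum>(c, m)\<leftarrow>L. c * monomial n n m (entries g)))"

lemma polynomial_function_poly_fun:
  assumes "polynomial_function_on_GL n f" shows "poly_fun n f"
proof -
  obtain M c where M: "finite M" "\<forall>g\<in>carrier (GL n). f g = (\<Sum>m\<in>M. c m * monomial n n m (entries g))"
    using assms by (auto simp: polynomial_function_on_GL_def monomial_def)
  obtain ms where ms: "set ms = M" "distinct ms" using finite_distinct_list[OF M(1)] by auto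
  have "(\<Sum>(c, m)\<leftarrow>map (\<lambda>m. (c m, m)) ms. c * monomial n n m X) = (\<Sum>m\<in>M. c m * monomial n n m X)" for X
    using ms by (simp add: o_def sum_list_distinct_conv_sum_set)
  then show ?thesis unfolding poly_fun_def using M by (intro exI[of _ "map (\<lambda>m. (c m, m)) ms"]) auto
qed

lemma poly_fun_add:
  assumes "poly_fun n f" "poly_fun n f'" shows "poly_fun n (\<lambda>g. f g + f' g)"
proof -
  obtain L L' where "\<forall>g\<in>carrier (GL n). f g = (\<Sum>(c, m)\<leftarrow>L. c * monomial n n m (entries g))"
    "\<forall>g\<in>carrier (GL n). f' g = (\<Sum>(c, m)\<leftarrow>L'. c * monomial n n m (entries g))"
    using assms by (auto simp: poly_fun_def)
  then show ?thesis unfolding poly_fun_def by (intro exI[of _ "L @ L'"]) simp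
qed

lemma poly_fun_zero: "poly_fun n (\<lambda>g. 0)"
  unfolding poly_fun_def by (intro exI[of _ "[]"]) simp

lemma poly_fun_one: "poly_fun n (\<lambda>g. 1)"
  unfolding poly_fun_def by (intro exI[of _ "[(1, \<lambda>p q. 0)]"]) (simp add: monomial_def)

lemma poly_fun_mult:
  assumes "poly_fun n f" "poly_fun n f'" shows "poly_fun n (\<lambda>g. f g * f' g)"
proof -
  obtain L L' where L: "\<forall>g\<in>carrier (GL n). f g = (\<Sum>(c, m)\<leftarrow>L. c * monomial n n m (entries g))"
    "\<forall>g\<in>carrier (GL n). f' g = (\<Sum>(c, m)\<leftarrow>L'. c * monomial n n m (entries g))"
    using assms by (auto simp: poly_fun_def)
  let ?S = "\<lambda>L X. \<Sum>(c, m)\<leftarrow>L. c * monomial n n m X"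
  let ?s = "\<lambda>c m L. map (\<lambda>(c', m'). (c * c', \<lambda>p q. m p q + m' p q)) L"
  have mon: "monomial n n (\<lambda>p q. m p q + m' p q) X = monomial n n m X * monomial n n m' X" for m m' X
    by (simp add: monomial_def power_add prod.distrib)
  have 1: "?S (?s c m L) X = c * monomial n n m X * ?S L X" for c m L X
    by (induction L) (auto simp: mon algebra_simps)
  have "?S (concat (map (\<lambda>(c, m). ?s c m L') L)) X = ?S L X * ?S L' X" for X
  proof (induction L)
    case (Cons x L)
    obtain c m where x: "x = (c, m)" by (cases x)
    show ?case using Cons.IH by (simp add: x 1 distrib_right del: map_map)
  qed simp
  then show ?thesis using L unfolding poly_fun_def
    by (intro exI[of _ "concat (map (\<lambda>(c, m). ?s c m L') L)"]) simp
qed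

lemma poly_fun_const: "poly_fun n (\<lambda>g. c)"
  unfolding poly_fun_def by (intro exI[of _ "[(c, \<lambda>p q. 0)]"]) (simp add: monomial_def)

lemma poly_fun_sum:
  "(\<And>i. i \<in> I \<Longrightarrow> poly_fun n (f i)) \<Longrightarrow> poly_fun n (\<lambda>g. \<Sum>i\<in>I. f i g)"
  by (induction I rule: infinite_finite_induct) (auto simp: poly_fun_zero intro: poly_fun_add)

lemma torus_characters_independent:
  fixes z :: "(nat \<Rightarrow> nat) \<Rightarrow> complex"
  assumes "finite K" "\<And>w j. w \<in> K \<Longrightarrow> n \<le> j \<Longrightarrow> w j = 0"
    and "\<And>t. \<forall>j. t j \<noteq> 0 \<Longrightarrow> (\<Sum>w\<in>K. z w * (\<Prod>j<n. t j ^ w j)) = 0" and "w \<in> K"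
  shows "z w = 0"
proof (rule independence_of_characters[where \<chi> = "\<lambda>w t. \<Prod>j<n. t j ^ w j" and S = "{t. \<forall>j. t j \<noteq> 0}"
      and e = "\<lambda>j. 1" and op = "\<lambda>x y j. x j * y j" and z = z])
  fix k l assume kl: "k \<in> K" "l \<in> K" "k \<noteq> l"
  define m where "m w = (\<lambda>p (i::nat). if p < n \<and> i < 1 then w p else 0)" for w :: "nat \<Rightarrow> nat"
  obtain j where j: "k j \<noteq> l j" using kl by auto
  have mem: "m w \<in> exponents n 1 (\<lambda>i. \<Sum>p<n. w p)" for w by (auto simp: exponents_def m_def)
  have "j < n" using j assms(2)[of k j] assms(2)[of l j] kl by (cases "j < n") auto
  then have "m k j 0 \<noteq> m l j 0" using j by (simp add: m_def)
  then have "m k \<noteq> m l" by metis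
  from monomial_separates[OF mem mem this] obtain X where
    "\<forall>p i. X p i \<noteq> 0" "monomial n 1 (m k) X \<noteq> monomial n 1 (m l) X" by blast
  moreover have "monomial n 1 (m w) X = (\<Prod>p<n. X p 0 ^ w p)" for w
    by (simp add: monomial_def m_def)
  ultimately have "(\<forall>p. X p 0 \<noteq> 0) \<and> (\<Prod>p<n. X p 0 ^ k p) \<noteq> (\<Prod>p<n. X p 0 ^ l p)" by simp
  then show "\<exists>t\<in>{t :: nat \<Rightarrow> complex. \<forall>j. t j \<noteq> 0}. (\<Prod>j<n. t j ^ k j) \<noteq> (\<Prod>j<n. t j ^ l j)"
    by (auto intro!: exI[of _ "\<lambda>p. X p 0"])
qed (use assms in \<open>auto simp: power_mult_distrib prod.distrib\<close>)

text \<open>Substituting \<open>g * diag n t\<close> for \<open>g\<close> multiplies a monomial by \<open>t\<close> to the power of its column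
  degrees. By independence of the characters of the torus, only the terms with column degrees
  \<open>(a\<^sub>0, \<dots>, a\<^bsub>r-1\<^esub>, 0, \<dots>, 0)\<close> contribute to \<open>f\<close>; since exponents are nonnegative, these terms do not
  involve the last \<open>n - r\<close> columns at all. This is the point at which polynomiality of the
  representations enters: the torus weight alone makes the function depend on few columns.\<close>

lemma polynomial_of_right_weight:
  assumes rn: "r \<le> n" and f: "poly_fun n f"
    and wt: "\<And>g t. g \<in> carrier (GL n) \<Longrightarrow> \<forall>j. t j \<noteq> 0 \<Longrightarrow> f (g * diag n t) = (\<Prod>i<r. t i ^ a i) * f g"
  obtains c where "\<And>g. g \<in> carrier (GL n) \<Longrightarrow>
    f g = (\<Sum>m\<in>exponents n r a. c m * monomial n r m (entries g))"
proof -
  obtain L where L: "\<forall>g\<in>carrier (GL n). f g = (\<Sum>(c, m)\<leftarrow>L. c * monomial n n m (entries g))"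
    using f by (auto simp: poly_fun_def)
  define c where "c k = fst (L ! k)" for k
  define e where "e k = snd (L ! k)" for k
  let ?I = "{..<length L}"
  have f_sum: "f g = (\<Sum>k\<in>?I. c k * monomial n n (e k) (entries g))" if "g \<in> carrier (GL n)" for g
    using L that by (simp add: sum_list_sum_nth case_prod_unfold c_def e_def atLeast0LessThan)
  define w where "w k = (\<lambda>j. if j < n then \<Sum>p<n. e k p j else 0)" for k
  define w0 where "w0 = (\<lambda>j. if j < r then a j else 0)"
  define I0 where "I0 = {k\<in>?I. w k = w0}"
  have w0_prod: "(\<Prod>j<n. t j ^ w0 j) = (\<Prod>i<r. t i ^ a i)" for t :: "nat \<Rightarrow> complex"
    using rn by (intro prod.mono_neutral_cong_right) (auto simp: w0_def)
  have proj: "f g = (\<Sum>k\<in>I0. c k * monomial n n (e k) (entries g))" if g: "g \<in> carrier (GL n)" for g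
  proof -
    let ?m = "\<lambda>k. c k * monomial n n (e k) (entries g)"
    let ?K = "insert w0 (w ` ?I)"
    define z where "z v = (\<Sum>k | k \<in> ?I \<and> w k = v. ?m k) - (if v = w0 then f g else 0)" for v
    \<comment> \<open>\<open>z v\<close> is the coefficient of the character \<open>v\<close> in the weight condition at the point \<open>g\<close>.\<close>
    have "z w0 = 0"
    proof (rule torus_characters_independent[where K = ?K and n = n and z = z])
      fix t :: "nat \<Rightarrow> complex" assume t: "\<forall>j. t j \<noteq> 0"
      let ?\<chi> = "\<lambda>v. \<Prod>j<n. t j ^ v j"
      have gt: "g * diag n t \<in> carrier (GL n)" using g t by (intro GL_mult_closed diag_GL) auto
      have mon: "monomial n n (e k) (entries (g * diag n t)) = ?\<chi> (w k) * monomial n n (e k) (entries g)" for k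
      proof -
        have "monomial n n (e k) (entries (g * diag n t)) = monomial n n (e k) (\<lambda>p i. t i * g $$ (p, i))"
          using GL_carrier_mat[OF g] by (intro monomial_cong) (auto simp: mult_diag_index[of _ n n])
        then show ?thesis by (simp add: monomial_scale_columns w_def)
      qed
      have "(\<Sum>v\<in>?K. (\<Sum>k | k \<in> ?I \<and> w k = v. ?m k) * ?\<chi> v) = (\<Sum>v\<in>?K. (\<Sum>k | k \<in> ?I \<and> w k = v. ?m k * ?\<chi> (w k)))"
        by (intro sum.cong) (auto simp: sum_distrib_right)
      also have "\<dots> = (\<Sum>k\<in>?I. ?m k * ?\<chi> (w k))" by (intro sum.group) auto
      also have "\<dots> = f (g * diag n t)" unfolding f_sum[OF gt] by (intro sum.cong) (auto simp: mon)
      also have "\<dots> = ?\<chi> w0 * f g" using wt[OF g t] w0_prod by simp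
      also have "\<dots> = (\<Sum>v\<in>?K. (if v = w0 then f g else 0) * ?\<chi> v)"
      proof -
        have "(\<Sum>v\<in>?K. (if v = w0 then f g else 0) * ?\<chi> v) = (\<Sum>v\<in>?K. if v = w0 then f g * ?\<chi> v else 0)"
          by (intro sum.cong) auto
        also have "\<dots> = f g * ?\<chi> w0" by (subst sum.delta) auto
        finally show ?thesis by simp
      qed
      finally show "(\<Sum>v\<in>?K. z v * ?\<chi> v) = 0"
        by (simp only: z_def left_diff_distrib sum_subtractf diff_self)
    qed (use rn in \<open>auto simp: w_def w0_def\<close>)
    then show ?thesis by (simp add: z_def I0_def)
  qed
  define trim where "trim k = (\<lambda>p i. if p < n \<and> i < r then e k p i else 0)" for k
  have col: "(\<Sum>p<n. e k p j) = w0 j" if "k \<in> I0" "j < n" for k j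
  proof -
    have "w k j = w0 j" using that by (simp add: I0_def)
    then show ?thesis using that by (simp add: w_def)
  qed
  have trim_mem: "trim k \<in> exponents n r a" if "k \<in> I0" for k
    using col[OF that] rn by (auto simp: exponents_def trim_def w0_def)
  have trim_mon: "monomial n n (e k) X = monomial n r (trim k) X" if k: "k \<in> I0" for k X
  proof -
    have "e k p i = 0" if "p < n" "r \<le> i" "i < n" for p i
      using col[OF k, of i] that by (simp add: w0_def)
    then have "(\<Prod>i<n. X p i ^ e k p i) = (\<Prod>i<r. X p i ^ trim k p i)" if "p < n" for p
      using rn that by (intro prod.mono_neutral_cong_right) (auto simp: trim_def)
    then show ?thesis by (simp add: monomial_def)
  qed
  show ?thesis
  proof (rule that)
    fix g assume g: "g \<in> carrier (GL n)"
    have "f g = (\<Sum>k\<in>I0. c k * monomial n r (trim k) (entries g))"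
      unfolding proj[OF g] by (intro sum.cong) (auto simp: trim_mon)
    also have "\<dots> = (\<Sum>m\<in>exponents n r a. \<Sum>k | k \<in> I0 \<and> trim k = m. c k * monomial n r (trim k) (entries g))"
      by (intro sum.group[symmetric]) (auto simp: finite_exponents trim_mem I0_def)
    also have "\<dots> = (\<Sum>m\<in>exponents n r a. (\<Sum>k | k \<in> I0 \<and> trim k = m. c k) * monomial n r m (entries g))"
      by (intro sum.cong) (auto simp: sum_distrib_right)
    finally show "f g = \<dots>" .
  qed
qed

text \<open>The first \<open>r\<close> columns of invertible matrices are dense: pad \<open>X\<close> with zero columns to a square
  matrix \<open>Y\<close>. Then \<open>Y + s\<close> is invertible unless \<open>- s\<close> is an eigenvalue, so the relation, which is
  polynomial in \<open>s\<close>, has infinitely many zeros, and it holds at \<open>s = 0\<close> too.\<close>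

lemma monomials_independent_on_GL:
  assumes rn: "r \<le> n"
    and zero: "\<And>g. g \<in> carrier (GL n) \<Longrightarrow> (\<Sum>m\<in>exponents n r a. z m * monomial n r m (entries g)) = 0"
    and m: "m \<in> exponents n r a"
  shows "z m = 0"
proof (rule monomials_independent[OF _ m])
  fix X :: "nat \<Rightarrow> nat \<Rightarrow> complex"
  define Y where "Y = mat n n (\<lambda>(p, i). if i < r then X p i else 0)"
  have Y: "Y \<in> carrier_mat n n" by (simp add: Y_def)
  define G where "G s = char_matrix Y (- s)" for s
  have G: "G s \<in> carrier_mat n n" for s using Y by (simp add: G_def char_matrix_def)
  have G_index: "G s $$ (p, i) = X p i + (if p = i then s else 0)" if "p < n" "i < r" for s p i
    using that rn by (simp add: G_def char_matrix_def Y_def)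
  define P where "P = (\<Sum>m\<in>exponents n r a. [:z m:] *
    (\<Prod>p<n. \<Prod>i<r. [:X p i, if p = i then 1 else 0:] ^ m p i))"
  have P: "poly P s = (\<Sum>m\<in>exponents n r a. z m * monomial n r m (entries (G s)))" for s
  proof -
    have "monomial n r m (entries (G s)) = (\<Prod>p<n. \<Prod>i<r. (X p i + (if p = i then s else 0)) ^ m p i)" for m
      unfolding monomial_def by (intro prod.cong) (auto simp: G_index)
    moreover have "poly [:X p i, if p = i then 1 else 0:] s = X p i + (if p = i then s else 0)" for p i
      by simp
    ultimately show ?thesis by (simp only: P_def poly_sum poly_mult poly_prod poly_power) simp
  qed
  have "char_poly Y \<noteq> 0" using degree_monic_char_poly[OF Y] by auto
  then have "finite {e. poly (char_poly Y) e = 0}" by (rule poly_roots_finite)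
  then have fin: "finite (uminus ` {e. poly (char_poly Y) e = 0})" by simp
  have "poly P s = 0" if "s \<notin> uminus ` {e. poly (char_poly Y) e = 0}" for s
  proof -
    have "poly (char_poly Y) (- s) \<noteq> 0"
    proof
      assume "poly (char_poly Y) (- s) = 0"
      then have "s \<in> uminus ` {e. poly (char_poly Y) e = 0}" by (intro image_eqI[of _ _ "- s"]) auto
      with that show False ..
    qed
    then have "det (G s) \<noteq> 0"
      unfolding G_def using eigenvalue_det[OF Y] eigenvalue_root_char_poly[OF Y] by blast
    then show ?thesis unfolding P by (intro zero det_nonzero_GL G)
  qed
  then have "- (uminus ` {e. poly (char_poly Y) e = 0}) \<subseteq> {s. poly P s = 0}" by blast
  moreover have "infinite (- (uminus ` {e. poly (char_poly Y) e = 0}))"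
    using fin by (simp add: infinite_UNIV_char_0 Compl_eq_Diff_UNIV)
  ultimately have "infinite {s. poly P s = 0}" using infinite_super by blast
  then have "P = 0" using poly_roots_finite by blast
  then have "(\<Sum>m\<in>exponents n r a. z m * monomial n r m (entries (G 0))) = 0" using P[of 0] by simp
  moreover have "monomial n r m (entries (G 0)) = monomial n r m X" for m
    by (intro monomial_cong) (simp add: G_index)
  ultimately show "(\<Sum>m\<in>exponents n r a. z m * monomial n r m X) = 0" by simp
qed

section \<open>The multinomial theorem\<close>

text \<open>The single column of the exponents in \<open>exponents n 1 (\<lambda>_. a)\<close> runs through the compositions of
  \<open>a\<close> into \<open>n\<close> parts. The induction splits off the last variable by the binomial theorem.\<close>

lemma multinomial_theorem:
  fixes x :: "nat \<Rightarrow> complex"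
  shows "(\<Sum>p<n. x p) ^ a = (\<Sum>m\<in>exponents n 1 (\<lambda>_. a).
    fact a / (\<Prod>p<n. fact (m p 0)) * (\<Prod>p<n. x p ^ m p 0))"
proof (induction n arbitrary: a)
  case 0
  have "exponents 0 1 (\<lambda>_. a) = (if a = 0 then {\<lambda>_ _. 0} else {})"
    by (auto simp: exponents_def)
  then show ?case by simp
next
  case (Suc n)
  let ?E = "\<lambda>n a. exponents n 1 (\<lambda>_. a)"
  let ?t = "\<lambda>n a m. fact a / (\<Prod>p<n. fact (m p 0)) * (\<Prod>p<n. x p ^ m p 0) :: complex"
  have "(\<Sum>p<Suc n. x p) ^ a = (\<Sum>k\<le>a. of_nat (a choose k) * (\<Sum>p<n. x p) ^ k * x n ^ (a - k))"
    by (simp add: binomial_ring)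
  also have "\<dots> = (\<Sum>k\<le>a. \<Sum>m\<in>?E n k. of_nat (a choose k) * ?t n k m * x n ^ (a - k))"
    by (simp only: Suc.IH sum_distrib_left sum_distrib_right)
  also have "\<dots> = (\<Sum>(k, m)\<in>Sigma {..a} (?E n). of_nat (a choose k) * ?t n k m * x n ^ (a - k))"
    by (intro sum.Sigma) (auto simp: finite_exponents)
  also have "\<dots> = (\<Sum>m\<in>?E (Suc n) a. ?t (Suc n) a m)"
  proof (rule sum.reindex_bij_witness[where j = "\<lambda>(k, m). m(n := \<lambda>i. if i = 0 then a - k else 0)"
        and i = "\<lambda>m. (\<Sum>p<n. m p 0, m(n := \<lambda>_. 0))"])
    fix km assume "km \<in> Sigma {..a} (?E n)"
    then obtain k m where km: "km = (k, m)" "k \<le> a" "m \<in> ?E n k" by auto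
    let ?m = "m(n := \<lambda>i. if i = 0 then a - k else 0)"
    have mn: "m n = (\<lambda>_. 0)" and sm: "(\<Sum>p<n. m p 0) = k" using km by (auto simp: exponents_def)
    have below: "(\<Sum>p<n. ?m p 0) = (\<Sum>p<n. m p 0)" "(\<Prod>p<n. fact (?m p 0)) = (\<Prod>p<n. fact (m p 0) :: complex)"
      "(\<Prod>p<n. x p ^ ?m p 0) = (\<Prod>p<n. x p ^ m p 0)"
      by (auto intro!: sum.cong prod.cong)
    have top: "?m n 0 = a - k" by simp
    show "(case (case km of (k, m) \<Rightarrow> m(n := \<lambda>i. if i = 0 then a - k else 0)) of
        m \<Rightarrow> (\<Sum>p<n. m p 0, m(n := \<lambda>_. 0))) = km"
      using km mn sm below by (auto simp: fun_eq_iff)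
    show "(case km of (k, m) \<Rightarrow> m(n := \<lambda>i. if i = 0 then a - k else 0)) \<in> ?E (Suc n) a"
      using km below sm by (auto simp: exponents_def)
    show "?t (Suc n) a (case km of (k, m) \<Rightarrow> m(n := \<lambda>i. if i = 0 then a - k else 0))
      = (case km of (k, m) \<Rightarrow> of_nat (a choose k) * ?t n k m * x n ^ (a - k))"
      using km(2) unfolding km(1) by (simp add: below top binomial_fact field_simps del: fun_upd_apply) 
  next
    fix m assume m: "m \<in> ?E (Suc n) a"
    then have "(\<Sum>p<n. m p 0) + m n 0 = a" by (auto simp: exponents_def)
    then show "(\<Sum>p<n. m p 0, m(n := \<lambda>_. 0)) \<in> Sigma {..a} (?E n)"
      "(case (\<Sum>p<n. m p 0, m(n := \<lambda>_. 0)) of (k, m) \<Rightarrow> m(n := \<lambda>i. if i = 0 then a - k else 0)) = m"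
      using m by (auto simp: exponents_def fun_eq_iff)
  qed
  finally show ?case .
qed

section \<open>Monomial models of representations\<close>

definition monomial_vec :: "nat \<Rightarrow> nat \<Rightarrow> (nat \<Rightarrow> nat \<Rightarrow> nat \<Rightarrow> nat) \<Rightarrow> nat \<Rightarrow> (nat \<Rightarrow> nat \<Rightarrow> complex) \<Rightarrow> complex vec" where
  "monomial_vec n r A N X = vec N (\<lambda>k. monomial n r (A k) X)"

lemma monomial_vec_carrier [simp]: "monomial_vec n r A N X \<in> carrier_vec N"
  by (simp add: monomial_vec_def)

lemma monomial_vec_cong:
  "(\<And>p i. p < n \<Longrightarrow> i < r \<Longrightarrow> X p i = Y p i) \<Longrightarrow> monomial_vec n r A N X = monomial_vec n r A N Y"
  unfolding monomial_vec_def by (simp add: monomial_cong[of n r X Y])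

text \<open>The columns of \<open>U\<close> form a basis \<open>u\<^sub>k\<close> of the representation space, indexed by the exponents
  \<open>A k\<close>, such that the polynomial map \<open>X \<mapsto> \<Sum>k<N. X\<^bsup>A k\<^esup> u\<^sub>k\<close> on \<open>n\<close> by \<open>r\<close> matrices is equivariant. It is
  the map to \<open>Sym\<^bsup>a 0\<^esup> \<otimes> \<dots> \<otimes> Sym\<^bsup>a (r-1)\<^esup>\<close> that sends \<open>X\<close> to the tensor product of the \<open>a i\<close>-th
  powers of its columns. The two-sided inverse \<open>L\<close> expresses that the \<open>u\<^sub>k\<close>
  are independent and span.\<close>

definition monomial_model ::
  "nat \<Rightarrow> nat \<Rightarrow> (nat \<Rightarrow> nat) \<Rightarrow> nat \<Rightarrow> (complex mat \<Rightarrow> complex mat) \<Rightarrow>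
    nat \<Rightarrow> (nat \<Rightarrow> nat \<Rightarrow> nat \<Rightarrow> nat) \<Rightarrow> complex mat \<Rightarrow> complex mat \<Rightarrow> bool" where
  "monomial_model n r a D \<rho> N A U L \<longleftrightarrow>
    bij_betw A {..<N} (exponents n r a) \<and> U \<in> carrier_mat D N \<and> L \<in> carrier_mat N D \<and>
    U * L = 1\<^sub>m D \<and> L * U = 1\<^sub>m N \<and>
    (\<forall>g\<in>carrier (GL n). \<forall>X. \<rho> g *\<^sub>v (U *\<^sub>v monomial_vec n r A N X) = U *\<^sub>v monomial_vec n r A N (act n g X))"

lemma mult_monomial_vec_index:
  assumes "M \<in> carrier_mat q N" "bij_betw A {..<N} (exponents n r a)" "k < q"
  shows "(M *\<^sub>v monomial_vec n r A N X) $ k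
    = (\<Sum>m\<in>exponents n r a. M $$ (k, inv_into {..<N} A m) * monomial n r m X)"
proof -
  have "(M *\<^sub>v monomial_vec n r A N X) $ k = (\<Sum>l<N. M $$ (k, l) * monomial n r (A l) X)"
    using assms by (auto simp: monomial_vec_def scalar_prod_def atLeast0LessThan intro!: sum.cong)
  also have "\<dots> = (\<Sum>l<N. M $$ (k, inv_into {..<N} A (A l)) * monomial n r (A l) X)"
    using assms(2) by (intro sum.cong) (auto simp: bij_betw_def inv_into_f_f)
  also have "\<dots> = (\<Sum>m\<in>exponents n r a. M $$ (k, inv_into {..<N} A m) * monomial n r m X)"
    by (rule sum.reindex_bij_betw[OF assms(2), of "\<lambda>m. M $$ (k, inv_into {..<N} A m) * monomial n r m X"])
  finally show ?thesis .
qed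

text \<open>The vectors of monomials in the first columns of invertible matrices span the whole space.\<close>

lemma mat_eq_on_GL_monomials:
  assumes "r \<le> n" "bij_betw A {..<N} (exponents n r a)"
    and M: "M \<in> carrier_mat q N" "M' \<in> carrier_mat q N"
    and eq: "\<And>g. g \<in> carrier (GL n) \<Longrightarrow> M *\<^sub>v monomial_vec n r A N (entries g) = M' *\<^sub>v monomial_vec n r A N (entries g)"
  shows "M = M'"
proof (rule eq_matI)
  fix k l assume "k < dim_row M'" "l < dim_col M'"
  then have kl: "k < q" "l < N" using M by auto
  let ?i = "inv_into {..<N} A"
  have "M $$ (k, ?i (A l)) - M' $$ (k, ?i (A l)) = 0"
  proof (rule monomials_independent_on_GL[OF assms(1), where z = "\<lambda>m. M $$ (k, ?i m) - M' $$ (k, ?i m)"])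
    fix g assume "g \<in> carrier (GL n)"
    from arg_cong[OF eq[OF this], of "\<lambda>v. v $ k"]
    show "(\<Sum>m\<in>exponents n r a. (M $$ (k, ?i m) - M' $$ (k, ?i m)) * monomial n r m (entries g)) = 0"
      using mult_monomial_vec_index[OF M(1) assms(2) kl(1)] mult_monomial_vec_index[OF M(2) assms(2) kl(1)]
      by (simp add: left_diff_distrib sum_subtractf)
  next
    show "A l \<in> exponents n r a" using assms(2) kl by (auto simp: bij_betw_def)
  qed
  moreover have "?i (A l) = l" using assms(2) kl by (auto simp: bij_betw_def inv_into_f_f)
  ultimately show "M $$ (k, l) = M' $$ (k, l)" by simp
qed (use M in auto)

lemma act_mult:
  assumes "g \<in> carrier_mat n n" "h \<in> carrier_mat n n" "p < n" "i < n"
  shows "act n g (entries h) p i = (g * h) $$ (p, i)"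
  using index_mult_sum[OF assms(1,2,3,4)] by (simp add: act_def)

lemma monomial_vec_act_entries:
  assumes "r \<le> n" "g \<in> carrier (GL n)" "h \<in> carrier (GL n)"
  shows "monomial_vec n r A N (act n g (entries h)) = monomial_vec n r A N (entries (g * h))"
  using assms GL_carrier_mat by (intro monomial_vec_cong act_mult) auto

text \<open>If the first entry is nonzero, a lower triangular matrix will do; otherwise swap two rows.\<close>

lemma GL_first_column:
  assumes "q < n" "x q \<noteq> 0"
  obtains g where "g \<in> carrier (GL n)" "\<And>p. p < n \<Longrightarrow> g $$ (p, 0) = x p"
proof -
  have main: "\<exists>g\<in>carrier (GL n). \<forall>p<n. g $$ (p, 0) = y p" if y: "y 0 \<noteq> 0" for y :: "nat \<Rightarrow> complex"
  proof (intro bexI allI impI)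
    let ?g = "mat n n (\<lambda>(p, i). if i = 0 then y p else if p = i then 1 else 0)"
    show "?g $$ (p, 0) = y p" if "p < n" for p using that by simp
    have "det ?g = prod_list (diag_mat ?g)" by (rule det_lower_triangular[where n = n]) auto
    also have "\<dots> = (\<Prod>p<n. if p = 0 then y 0 else 1)"

      by (simp add: diag_mat_def prod.list_conv_set_nth atLeast0LessThan cong: if_cong)
    also have "\<dots> = y 0" using assms by simp
    finally show "?g \<in> carrier (GL n)" using y by (intro det_nonzero_GL) auto
  qed
  have n: "0 < n" using assms by simp
  let ?s = "swaprows_mat n 0 q :: complex mat"
  have s: "?s \<in> carrier (GL n)"
    using swaprows_mat_Unit[of 0 n q "()", where ?'a = complex] assms n by (simp add: units_of_def)
  obtain g where g: "g \<in> carrier (GL n)" "\<forall>p<n. g $$ (p, 0) = x (if p = 0 then q else if p = q then 0 else p)"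
    using main[of "\<lambda>p. x (if p = 0 then q else if p = q then 0 else p)"] assms by auto
  show ?thesis
  proof (rule that)
    show "?s * g \<in> carrier (GL n)" by (intro GL_mult_closed s g)
    show "(?s * g) $$ (p, 0) = x p" if "p < n" for p
    proof -
      have "?s * g = swaprows 0 q g" by (rule swaprows_mat[symmetric]) (use GL_carrier_mat[OF g(1)] n assms in auto)
      then show ?thesis using GL_carrier_mat[OF g(1)] g(2) assms that n by auto
    qed
  qed
qed

section \<open>The representation with highest weight (a, 0, ..., 0)\<close>

lemma GL_rep_carrier: "GL_rep n d \<rho> \<Longrightarrow> g \<in> carrier (GL n) \<Longrightarrow> \<rho> g \<in> carrier_mat d d"
  unfolding GL_rep_def using GL_carrier_mat by (blast dest: hom_in_carrier)

lemma GL_rep_mult: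
  "GL_rep n d \<rho> \<Longrightarrow> g \<in> carrier (GL n) \<Longrightarrow> h \<in> carrier (GL n) \<Longrightarrow> \<rho> (g * h) = \<rho> g * \<rho> h"
  unfolding GL_rep_def by (drule hom_mult[of _ _ _ g h]) auto

text \<open>The orbit of \<open>v\<close> spans the irreducible representation. The span is taken as the double
  annihilator \<open>W\<close> of the orbit, which is visibly an invariant subspace.\<close>

lemma orbit_functional_zero:
  assumes irr: "irreducible_rep n d \<rho>" and v: "v \<in> carrier_vec d" "v \<noteq> 0\<^sub>v d"
    and one: "\<rho> (1\<^sub>m n) *\<^sub>v v = v"
    and x: "x \<in> carrier_vec d" "\<And>g. g \<in> carrier (GL n) \<Longrightarrow> x \<bullet> (\<rho> g *\<^sub>v v) = 0"
  shows "x = 0\<^sub>v d"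
proof -
  have rep: "GL_rep n d \<rho>" using irr by (simp add: irreducible_rep_def)
  note car = GL_rep_carrier[OF rep]
  define A where "A = {y \<in> carrier_vec d. \<forall>g\<in>carrier (GL n). y \<bullet> (\<rho> g *\<^sub>v v) = 0}"
  define W where "W = {w \<in> carrier_vec d. \<forall>y\<in>A. y \<bullet> w = 0}"
  have "VectorSpace.subspace class_ring W (module_vec TYPE(complex) d)"
  proof -
    interpret vectorspace class_ring "module_vec TYPE(complex) d" by (rule vec_vs)
    show ?thesis
      unfolding VectorSpace.subspace_def
      by (intro conjI vectorspace_axioms, unfold_locales)
        (auto simp: W_def A_def module_vec_simps scalar_prod_add_distrib[of _ d])
  qed
  moreover have "\<rho> g *\<^sub>v w \<in> W" if g: "g \<in> carrier (GL n)" and w: "w \<in> W" for g w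
  proof -
    have "y \<bullet> (\<rho> g *\<^sub>v w) = 0" if y: "y \<in> A" for y
    proof -
      have yd: "y \<in> carrier_vec d" using y by (simp add: A_def)
      have "transpose_mat (\<rho> g) *\<^sub>v y \<in> A"
      proof -
        have "(transpose_mat (\<rho> g) *\<^sub>v y) \<bullet> (\<rho> h *\<^sub>v v) = 0" if h: "h \<in> carrier (GL n)" for h
        proof -
          have "(transpose_mat (\<rho> g) *\<^sub>v y) \<bullet> (\<rho> h *\<^sub>v v) = y \<bullet> (\<rho> g *\<^sub>v (\<rho> h *\<^sub>v v))"
            using car[OF g] car[OF h] yd v by (intro transpose_vec_mult_scalar) auto
          also have "\<dots> = y \<bullet> (\<rho> (g * h) *\<^sub>v v)"
            using car[OF g] car[OF h] v by (simp add: GL_rep_mult[OF rep g h])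
          also have "\<dots> = 0" using y GL_mult_closed[OF g h] by (simp add: A_def)
          finally show ?thesis .
        qed
        then show ?thesis using car[OF g] yd by (simp add: A_def)
      qed
      then have "(transpose_mat (\<rho> g) *\<^sub>v y) \<bullet> w = 0" using w by (simp add: W_def)
      then show ?thesis using transpose_vec_mult_scalar[OF car[OF g], of w y] w yd by (simp add: W_def)
    qed
    then show ?thesis using car[OF g] w by (simp add: W_def)
  qed
  moreover have "v \<in> W"
  proof -
    have "y \<bullet> v = 0" if "y \<in> A" for y
      using that one one_GL[of n] by (auto simp: A_def)
    then show ?thesis using v by (simp add: W_def)
  qed
  ultimately have "W = carrier_vec d" using irr v unfolding irreducible_rep_def by blast
  moreover have "x \<in> A" using x by (simp add: A_def)
  ultimately have orth: "x \<bullet> w = 0" if "w \<in> carrier_vec d" for w using that by (auto simp: W_def)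
  show ?thesis
  proof (rule eq_vecI)
    fix i assume "i < dim_vec (0\<^sub>v d :: complex vec)"
    then have i: "i < d" by simp
    have "x \<bullet> unit_vec d i = x $ i" using x i by (simp add: scalar_prod_right_unit)
    then show "x $ i = 0\<^sub>v d $ i" using orth[of "unit_vec d i"] i by simp
  qed (use x in auto)
qed

text \<open>Each coordinate of \<open>g \<mapsto> \<rho> g v\<close> has the right weight \<open>(a\<^sub>0, \<dots>, a\<^bsub>r-1\<^esub>, 0, \<dots>, 0)\<close>, so that
  \<open>polynomial_of_right_weight\<close> applies to it.\<close>

lemma weight_vector_orbit:
  assumes rn: "r \<le> n" and rep: "GL_rep n d \<rho>"
    and pf: "\<And>k l. k < d \<Longrightarrow> l < d \<Longrightarrow> poly_fun n (\<lambda>g. \<rho> g $$ (k, l))"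
    and v: "v \<in> carrier_vec d"
    and wt: "\<And>t. \<forall>j. t j \<noteq> 0 \<Longrightarrow> \<rho> (diag n t) *\<^sub>v v = (\<Prod>i<r. t i ^ a i) \<cdot>\<^sub>v v"
    and A: "bij_betw A {..<N} (exponents n r a)"
  obtains U where "U \<in> carrier_mat d N"
    "\<And>g. g \<in> carrier (GL n) \<Longrightarrow> \<rho> g *\<^sub>v v = U *\<^sub>v monomial_vec n r A N (entries g)"
proof -
  let ?E = "exponents n r a"
  note car = GL_rep_carrier[OF rep]
  have ex: "\<exists>c. \<forall>g\<in>carrier (GL n). (\<rho> g *\<^sub>v v) $ k = (\<Sum>m\<in>?E. c m * monomial n r m (entries g))"
    if k: "k < d" for k
  proof -
    let ?f = "\<lambda>g. \<Sum>l<d. \<rho> g $$ (k, l) * v $ l"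
    have f: "(\<rho> g *\<^sub>v v) $ k = ?f g" if "g \<in> carrier (GL n)" for g
      using car[OF that] v k by (auto simp: scalar_prod_def atLeast0LessThan intro!: sum.cong)
    have pf': "poly_fun n ?f"
      using pf k by (intro poly_fun_sum poly_fun_mult poly_fun_const) auto
    have wt': "?f (g * diag n t) = (\<Prod>i<r. t i ^ a i) * ?f g"
      if g: "g \<in> carrier (GL n)" and t: "\<forall>j. t j \<noteq> 0" for g t
    proof -
      have tg: "diag n t \<in> carrier (GL n)" using t by (intro diag_GL) auto
      have "\<rho> (g * diag n t) *\<^sub>v v = \<rho> g *\<^sub>v (\<rho> (diag n t) *\<^sub>v v)"
        using car[OF g] car[OF tg] v by (simp add: GL_rep_mult[OF rep g tg])
      also have "\<dots> = (\<Prod>i<r. t i ^ a i) \<cdot>\<^sub>v (\<rho> g *\<^sub>v v)"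
        unfolding wt[OF t] by (rule mult_mat_vec[OF car[OF g] v])
      finally have "(\<rho> (g * diag n t) *\<^sub>v v) $ k = (\<Prod>i<r. t i ^ a i) * (\<rho> g *\<^sub>v v) $ k"
        using car[OF g] k by simp
      then show ?thesis by (simp only: f[OF g] f[OF GL_mult_closed[OF g tg]])
    qed
    obtain c where "\<And>g. g \<in> carrier (GL n) \<Longrightarrow> ?f g = (\<Sum>m\<in>?E. c m * monomial n r m (entries g))"
      using polynomial_of_right_weight[OF rn pf' wt'] by blast
    then show ?thesis using f by auto
  qed
  have "\<exists>c. \<forall>k\<in>{..<d}. \<forall>g\<in>carrier (GL n).
      (\<rho> g *\<^sub>v v) $ k = (\<Sum>m\<in>?E. c k m * monomial n r m (entries g))"
    by (rule bchoice) (use ex in blast)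
  then obtain c where c: "\<And>k g. k < d \<Longrightarrow> g \<in> carrier (GL n) \<Longrightarrow>
      (\<rho> g *\<^sub>v v) $ k = (\<Sum>m\<in>?E. c k m * monomial n r m (entries g))"
    by blast
  define U where "U = mat d N (\<lambda>(k, l). c k (A l))"
  have U: "U \<in> carrier_mat d N" by (simp add: U_def)
  show ?thesis
  proof (rule that[OF U])
    fix g assume g: "g \<in> carrier (GL n)"
    show "\<rho> g *\<^sub>v v = U *\<^sub>v monomial_vec n r A N (entries g)"
    proof (rule eq_vecI)
      fix k assume "k < dim_vec (U *\<^sub>v monomial_vec n r A N (entries g))"
      then have k: "k < d" using U by simp
      have "(U *\<^sub>v monomial_vec n r A N (entries g)) $ k
          = (\<Sum>m\<in>?E. U $$ (k, inv_into {..<N} A m) * monomial n r m (entries g))"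
        by (rule mult_monomial_vec_index[OF U A k])
      also have "\<dots> = (\<Sum>m\<in>?E. c k m * monomial n r m (entries g))"
      proof (intro sum.cong refl)
        fix m assume m: "m \<in> ?E"
        then have "inv_into {..<N} A m < N" "A (inv_into {..<N} A m) = m"
          using A inv_into_into[of m A "{..<N}"] by (auto simp: bij_betw_def f_inv_into_f)
        then show "U $$ (k, inv_into {..<N} A m) * monomial n r m (entries g) = c k m * monomial n r m (entries g)"
          using k by (simp add: U_def)
      qed
      finally show "(\<rho> g *\<^sub>v v) $ k = (U *\<^sub>v monomial_vec n r A N (entries g)) $ k" using c[OF k g] by simp
    qed (use car[OF g] U in auto)
  qed
qed

text \<open>The orbit map of a highest weight vector \<open>v\<close> is \<open>\<rho> g v = \<phi> (g e\<^sub>0)\<close> with \<open>\<phi>\<close> homogeneous of degree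
  \<open>a\<close>, by \<open>weight_vector_orbit\<close>; this already exhibits the equivariant map, and it remains to see
  that the coefficient vectors of \<open>\<phi>\<close> form a basis. They span, because the orbit does. For the
  independence it suffices that each monomial of degree \<open>a\<close> is \<open>x \<bullet> \<phi>\<close> for some functional \<open>x\<close>.
  The polynomials of this form are a subspace \<open>Z\<close> invariant under linear substitutions, in particular
  under the torus, so with a polynomial \<open>Z\<close> contains all its monomials. Since \<open>\<phi> e\<^sub>0 = v \<noteq> 0\<close>, the
  monomial \<open>X\<^sub>0\<^sup>a\<close> is in \<open>Z\<close>, hence so is \<open>(X\<^sub>0 + \<dots> + X\<^bsub>n-1\<^esub>)\<^sup>a\<close>, in which every monomial of degree
  \<open>a\<close> occurs.\<close>

lemma F_rep_monomial_model:
  assumes F: "F_rep n a d \<rho>" and n: "n \<ge> 1"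
  obtains N A U L where "monomial_model n 1 (\<lambda>_. a) d \<rho> N A U L"
proof -
  let ?E = "exponents n 1 (\<lambda>_. a)"
  have irr: "irreducible_rep n d \<rho>" and pol: "polynomial_rep n d \<rho>" using F by (auto simp: F_rep_def)
  have rep: "GL_rep n d \<rho>" using irr by (simp add: irreducible_rep_def)
  note car = GL_rep_carrier[OF rep]
  obtain v where v: "v \<in> carrier_vec d" "v \<noteq> 0\<^sub>v d"
    and hw: "\<And>b. b \<in> carrier (GL n) \<Longrightarrow> upper_triangular b \<Longrightarrow>
      \<rho> b *\<^sub>v v = (\<Prod>i<n. b $$ (i, i) powi (if i = 0 then int a else 0)) \<cdot>\<^sub>v v"
    using F unfolding F_rep_def highest_weight_def by auto
  have hw': "\<rho> b *\<^sub>v v = (b $$ (0, 0) ^ a) \<cdot>\<^sub>v v" if "b \<in> carrier (GL n)" "upper_triangular b" for b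
  proof -
    have "(\<Prod>i<n. b $$ (i, i) powi (if i = 0 then int a else 0)) = (\<Prod>i<n. if i = 0 then b $$ (0, 0) ^ a else 1)"
      by (intro prod.cong) auto
    also have "\<dots> = b $$ (0, 0) ^ a" using n by simp
    finally show ?thesis using hw[OF that] by simp
  qed
  have one: "\<rho> (1\<^sub>m n) *\<^sub>v v = v"
    using hw'[OF one_GL] n by (simp add: upper_triangular_def)
  have "\<exists>A. bij_betw A {..<card ?E} ?E"
    using ex_bij_betw_nat_finite[OF finite_exponents] unfolding atLeast0LessThan .
  then obtain A and N :: nat where A: "bij_betw A {..<N} ?E" by blast
  have wt: "\<rho> (diag n t) *\<^sub>v v = (\<Prod>i<1. t i ^ a) \<cdot>\<^sub>v v" if "\<forall>j. t j \<noteq> 0" for t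
  proof -
    have "diag n t \<in> carrier (GL n)" using that by (intro diag_GL) auto
    from hw'[OF this diag_upper_triangular] show ?thesis using n by (simp add: diag_def)
  qed
  have pf: "poly_fun n (\<lambda>g. \<rho> g $$ (k, l))" if "k < d" "l < d" for k l
    using pol that unfolding polynomial_rep_def by (intro polynomial_function_poly_fun) auto
  let ?mv = "monomial_vec n 1 A N"
  obtain U where U: "U \<in> carrier_mat d N"
    and orbit: "\<And>g. g \<in> carrier (GL n) \<Longrightarrow> \<rho> g *\<^sub>v v = U *\<^sub>v ?mv (entries g)"
    using weight_vector_orbit[OF n rep pf v(1) wt A] by blast
  define c where "c k m = U $$ (k, inv_into {..<N} A m)" for k m
  have U_index: "(U *\<^sub>v ?mv X) $ k = (\<Sum>m\<in>?E. c k m * monomial n 1 m X)" if k: "k < d" for k X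
    unfolding c_def by (rule mult_monomial_vec_index[OF U A k])
  have equi: "\<rho> h *\<^sub>v (U *\<^sub>v ?mv X) = U *\<^sub>v ?mv (act n h X)" if h: "h \<in> carrier (GL n)"
    for h and X :: "nat \<Rightarrow> nat \<Rightarrow> complex"
  proof -
    have nonzero: "\<rho> h *\<^sub>v (U *\<^sub>v ?mv X) = U *\<^sub>v ?mv (act n h X)" if X: "q < n" "X q 0 \<noteq> 0" for X :: "nat \<Rightarrow> nat \<Rightarrow> complex" and q
    proof -
      obtain g where g: "g \<in> carrier (GL n)" "\<And>p. p < n \<Longrightarrow> g $$ (p, 0) = X p 0"
        using GL_first_column[of q n "\<lambda>p. X p 0"] X by metis
      have X_g: "?mv X = ?mv (entries g)" using g by (intro monomial_vec_cong) auto
      have "?mv (act n h X) = ?mv (act n h (entries g))"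
        using g by (intro monomial_vec_cong) (auto simp: act_def intro!: sum.cong)
      also have "\<dots> = ?mv (entries (h * g))" by (rule monomial_vec_act_entries[OF n h g(1)])
      finally have "U *\<^sub>v ?mv (act n h X) = \<rho> (h * g) *\<^sub>v v" using orbit[OF GL_mult_closed[OF h g(1)]] by simp
      also have "\<dots> = \<rho> h *\<^sub>v (\<rho> g *\<^sub>v v)" using car[OF g(1)] car[OF h] v by (simp add: GL_rep_mult[OF rep h g(1)])
      finally show ?thesis using orbit[OF g(1)] X_g by simp
    qed
    \<comment> \<open>The zero column does not occur in an invertible matrix; there the vector of monomials
      vanishes if \<open>a > 0\<close>, and it is constant if \<open>a = 0\<close>.\<close>
    show ?thesis
    proof (cases "\<exists>q<n. X q 0 \<noteq> 0")
      case True
      then show ?thesis using nonzero by blast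
    next
      case X0: False
      then have hX0: "act n h X p 0 = 0" for p by (simp add: act_def)
      show ?thesis
      proof (cases "a = 0")
        case True
        then have m0: "m p 0 = 0" if "m \<in> ?E" "p < n" for m p
          using that by (auto simp: exponents_def)
        have "monomial n 1 m X = 1" if "m \<in> ?E" for m and X :: "nat \<Rightarrow> nat \<Rightarrow> complex"
          using m0[OF that] by (auto simp: monomial_def intro!: prod.neutral)
        moreover have "A k \<in> ?E" if "k < N" for k using A that by (auto simp: bij_betw_def)
        ultimately have const: "?mv X = ?mv Y" for X Y by (auto simp: monomial_vec_def)
        show ?thesis using nonzero[of 0 "\<lambda>_ _. 1"] n
            const[of X "\<lambda>_ _. 1"] const[of "act n h X" "act n h (\<lambda>_ _. 1)"] by simp
      next
        case False
        have "monomial n 1 m Y = 0" if m: "m \<in> ?E" and Y: "\<forall>p<n. Y p 0 = 0" for m Y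
        proof -
          have "(\<Sum>p<n. m p 0) \<noteq> 0" using m False by (auto simp: exponents_def)
          then obtain p where "p < n" "m p 0 \<noteq> 0" by (metis lessThan_iff sum.neutral)
          then show ?thesis using Y by (auto simp: monomial_def)
        qed
        moreover have "A k \<in> ?E" if "k < N" for k using A that by (auto simp: bij_betw_def)
        ultimately have "?mv Y = 0\<^sub>v N" if "\<forall>p<n. Y p 0 = 0" for Y
          using that by (auto simp: monomial_vec_def)
        then have "?mv X = 0\<^sub>v N" "?mv (act n h X) = 0\<^sub>v N" using X0 hX0 by auto
        moreover have "M *\<^sub>v 0\<^sub>v q = 0\<^sub>v p" if "M \<in> carrier_mat p q" for M :: "complex mat" and p q
          using that by (intro eq_vecI) auto
        ultimately show ?thesis using U car[OF h] by simp
      qed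
    qed
  qed
  define Z where "Z y \<longleftrightarrow> (\<exists>x\<in>carrier_vec d. \<forall>X. x \<bullet> (U *\<^sub>v ?mv X) = (\<Sum>m\<in>?E. y m * monomial n 1 m X))"
    for y :: "(nat \<Rightarrow> nat \<Rightarrow> nat) \<Rightarrow> complex"
  have indicator: "\<exists>y'. Z y' \<and> y' \<gamma> = 1 \<and> (\<forall>k\<in>?E - {\<gamma>}. y' k = 0)"
    if y: "Z y" "\<gamma> \<in> ?E" "y \<gamma> \<noteq> 0" for y \<gamma>
  proof (rule indicator_from_characters[where \<chi> = "\<lambda>m X. monomial n 1 m (\<lambda>p i. X p 0)"
        and S = "{X :: nat \<Rightarrow> nat \<Rightarrow> complex. \<forall>p i. X p i \<noteq> 0}" and y = y])
    fix k l assume kl: "k \<in> ?E" "l \<in> ?E" "k \<noteq> l"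
    then obtain X where X: "\<forall>p i. X p i \<noteq> 0" "monomial n 1 k X \<noteq> monomial n 1 l X"
      using monomial_separates by blast
    have "monomial n 1 m (\<lambda>p i. X p 0) = monomial n 1 m X" for m
      by (intro monomial_cong) auto
    then show "\<exists>X\<in>{X :: nat \<Rightarrow> nat \<Rightarrow> complex. \<forall>p i. X p i \<noteq> 0}. monomial n 1 k (\<lambda>p i. X p 0) \<noteq> monomial n 1 l (\<lambda>p i. X p 0)"
      using X by (auto intro!: exI[of _ X])
  next
    fix y and t :: "nat \<Rightarrow> nat \<Rightarrow> complex" assume "Z y" and "t \<in> {X. \<forall>p i. X p i \<noteq> 0}"
    then obtain x where t: "\<forall>p i. t p i \<noteq> 0" and x: "x \<in> carrier_vec d"
      "\<And>X. x \<bullet> (U *\<^sub>v ?mv X) = (\<Sum>m\<in>?E. y m * monomial n 1 m X)"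
      unfolding Z_def by auto
    let ?t = "diag n (\<lambda>p. t p 0)"
    have tg: "?t \<in> carrier (GL n)" using t by (intro diag_GL) auto
    show "Z (\<lambda>k. monomial n 1 k (\<lambda>p i. t p 0) * y k)" unfolding Z_def
    proof (intro bexI allI)
      fix X
      have "(transpose_mat (\<rho> ?t) *\<^sub>v x) \<bullet> (U *\<^sub>v ?mv X) = x \<bullet> (U *\<^sub>v ?mv (act n ?t X))"
        using transpose_vec_mult_scalar[OF car[OF tg], of "U *\<^sub>v ?mv X" x] x(1) U equi[OF tg] by simp
      also have "\<dots> = (\<Sum>m\<in>?E. y m * monomial n 1 m (\<lambda>p i. t p 0 * X p i))"
        unfolding x(2) by (intro sum.cong refl arg_cong2[of _ _ _ _ "(*)"] monomial_cong act_diag)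
      also have "\<dots> = (\<Sum>m\<in>?E. monomial n 1 m (\<lambda>p i. t p 0) * y m * monomial n 1 m X)"
        by (intro sum.cong) (auto simp: monomial_mult)
      finally show "(transpose_mat (\<rho> ?t) *\<^sub>v x) \<bullet> (U *\<^sub>v ?mv X) = \<dots>" .
    qed (use car[OF tg] x in auto)
  next
    fix y y' c assume "Z y" "Z y'"
    then obtain x x' where x: "x \<in> carrier_vec d" "\<And>X. x \<bullet> (U *\<^sub>v ?mv X) = (\<Sum>m\<in>?E. y m * monomial n 1 m X)"
      and x': "x' \<in> carrier_vec d" "\<And>X. x' \<bullet> (U *\<^sub>v ?mv X) = (\<Sum>m\<in>?E. y' m * monomial n 1 m X)"
      unfolding Z_def by blast
    show "Z (\<lambda>k. y k + c * y' k)" unfolding Z_def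
    proof (intro bexI allI)
      fix X
      have Uv: "U *\<^sub>v ?mv X \<in> carrier_vec d" using U by simp
      have "(x + c \<cdot>\<^sub>v x') \<bullet> (U *\<^sub>v ?mv X) = x \<bullet> (U *\<^sub>v ?mv X) + c * (x' \<bullet> (U *\<^sub>v ?mv X))"
        using x(1) x'(1) Uv by (simp add: add_scalar_prod_distrib[of _ d])
      then show "(x + c \<cdot>\<^sub>v x') \<bullet> (U *\<^sub>v ?mv X) = (\<Sum>m\<in>?E. (y m + c * y' m) * monomial n 1 m X)"
        unfolding x(2) x'(2) by (simp add: sum.distrib sum_distrib_left algebra_simps)
    qed (use x x' in auto)
  qed (use y finite_exponents in auto)
  have indicator': "\<exists>x\<in>carrier_vec d. \<forall>X. x \<bullet> (U *\<^sub>v ?mv X) = monomial n 1 \<gamma> X"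
    if y: "Z y" "\<gamma> \<in> ?E" "y \<gamma> \<noteq> 0" for y \<gamma>
  proof -
    obtain y' where Z': "Z y'" and y': "y' \<gamma> = 1" "\<forall>k\<in>?E - {\<gamma>}. y' k = 0"
      using indicator[OF y] by blast
    obtain x where x: "x \<in> carrier_vec d"
      "\<forall>X. x \<bullet> (U *\<^sub>v ?mv X) = (\<Sum>m\<in>?E. y' m * monomial n 1 m X)"
      using Z' unfolding Z_def by blast
    have "(\<Sum>m\<in>?E. y' m * monomial n 1 m X) = (\<Sum>m\<in>?E. if m = \<gamma> then monomial n 1 m X else 0)" for X
      using y' by (intro sum.cong) auto
    then have "(\<Sum>m\<in>?E. y' m * monomial n 1 m X) = monomial n 1 \<gamma> X" for X
      using y(2) finite_exponents by simp
    then show ?thesis using x by auto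
  qed
  \<comment> \<open>The exponent of the monomial \<open>X\<^sub>0\<^sup>a\<close>.\<close>
  define \<gamma>0 where "\<gamma>0 = (\<lambda>(p::nat) (i::nat). if p = 0 \<and> i = 0 then a else 0)"
  have \<gamma>0: "\<gamma>0 \<in> ?E"
  proof -
    have "(\<Sum>p<n. \<gamma>0 p 0) = (\<Sum>p<n. if p = 0 then a else 0)" by (intro sum.cong) (auto simp: \<gamma>0_def)
    then show ?thesis using n by (auto simp: exponents_def \<gamma>0_def)
  qed
  have \<gamma>0_mon: "monomial n 1 \<gamma>0 X = X 0 0 ^ a" for X
  proof -
    have "monomial n 1 \<gamma>0 X = (\<Prod>p<n. if p = 0 then X 0 0 ^ a else 1)"
      unfolding monomial_def by (intro prod.cong) (auto simp: \<gamma>0_def)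
    then show ?thesis using n by simp
  qed
  obtain k where k: "k < d" "v $ k \<noteq> 0" using v by (metis eq_vecI carrier_vecD index_zero_vec)
  have "v $ k = c k \<gamma>0"
  proof -
    have other: "monomial n 1 m (entries (1\<^sub>m n)) = 0" if m: "m \<in> ?E" "m \<noteq> \<gamma>0" for m
    proof -
      have "\<exists>p<n. p \<noteq> 0 \<and> m p 0 \<noteq> 0"
      proof (rule ccontr)
        assume "\<not> ?thesis"
        then have z: "m p i = 0" if "p \<noteq> 0 \<or> i \<noteq> 0" for p i
          using m(1) that by (cases "p < n"; cases "i = 0") (auto simp: exponents_def)
        then have "(\<Sum>p<n. m p 0) = (\<Sum>p<n. if p = 0 then m 0 0 else 0)" by (intro sum.cong) auto
        then have "m 0 0 = a" using n m(1) by (auto simp: exponents_def)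
        then have "m = \<gamma>0" using z by (auto simp: fun_eq_iff \<gamma>0_def)
        with m show False by simp
      qed
      then show ?thesis using n by (auto simp: monomial_def)
    qed
    have "v $ k = (\<Sum>m\<in>?E. c k m * monomial n 1 m (entries (1\<^sub>m n)))"
      using U_index[OF k(1)] orbit[OF one_GL] one by metis
    also have "\<dots> = (\<Sum>m\<in>?E. if m = \<gamma>0 then c k m else 0)"
      using n by (intro sum.cong) (auto simp: other \<gamma>0_mon simp del: One_nat_def)
    also have "\<dots> = c k \<gamma>0" using \<gamma>0 finite_exponents by simp
    finally show ?thesis .
  qed
  moreover have "Z (c k)" unfolding Z_def
    using k U U_index by (intro bexI[of _ "unit_vec d k"]) (auto simp del: index_mult_mat_vec One_nat_def)
  ultimately obtain x0 where x0: "x0 \<in> carrier_vec d" "\<And>X. x0 \<bullet> (U *\<^sub>v ?mv X) = X 0 0 ^ a"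
    using indicator'[OF _ \<gamma>0, of "c k"] k \<gamma>0_mon by auto
  \<comment> \<open>Substituting by \<open>h\<close> replaces the first coordinate by the sum of all coordinates.\<close>
  define h where "h = mat n n (\<lambda>(p, q). if p = 0 \<or> p = q then 1 else 0 :: complex)"
  have h: "h \<in> carrier (GL n)"
  proof (rule det_nonzero_GL)
    have "det h = prod_list (diag_mat h)"
      by (rule det_upper_triangular[where n = n]) (auto simp: h_def upper_triangular_def)
    also have "\<dots> = 1" by (simp add: h_def diag_mat_def prod.list_conv_set_nth)
    finally show "det h \<noteq> 0" by simp
  qed (simp add: h_def)
  let ?multi = "\<lambda>m. fact a / (\<Prod>p<n. fact (m p 0)) :: complex"
  have "Z ?multi" unfolding Z_def
  proof (intro bexI allI)
    fix X
    have "(transpose_mat (\<rho> h) *\<^sub>v x0) \<bullet> (U *\<^sub>v ?mv X) = act n h X 0 0 ^ a"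
      using transpose_vec_mult_scalar[OF car[OF h], of "U *\<^sub>v ?mv X" x0] x0 U equi[OF h] by simp
    also have "act n h X 0 0 = (\<Sum>p<n. X p 0)"
      unfolding act_def using n by (intro sum.cong) (auto simp: h_def)
    also have "(\<Sum>p<n. X p 0) ^ a = (\<Sum>m\<in>?E. ?multi m * monomial n 1 m X)"
      unfolding multinomial_theorem by (simp add: monomial_def)
    finally show "(transpose_mat (\<rho> h) *\<^sub>v x0) \<bullet> (U *\<^sub>v ?mv X) = \<dots>" .
  qed (use car[OF h] x0 in auto)
  then have ex: "\<exists>x\<in>carrier_vec d. \<forall>X. x \<bullet> (U *\<^sub>v ?mv X) = monomial n 1 \<gamma> X" if "\<gamma> \<in> ?E" for \<gamma>
    using that by (intro indicator'[of ?multi]) auto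
  have "\<exists>x. \<forall>\<gamma>\<in>?E. x \<gamma> \<in> carrier_vec d \<and> (\<forall>X. x \<gamma> \<bullet> (U *\<^sub>v ?mv X) = monomial n 1 \<gamma> X)"
    by (rule bchoice) (use ex in blast)
  then obtain x where x: "\<And>\<gamma>. \<gamma> \<in> ?E \<Longrightarrow> x \<gamma> \<in> carrier_vec d"
    "\<And>\<gamma> X. \<gamma> \<in> ?E \<Longrightarrow> x \<gamma> \<bullet> (U *\<^sub>v ?mv X) = monomial n 1 \<gamma> X"
    by blast
  define L where "L = mat_of_rows d (map (\<lambda>l. x (A l)) [0..<N])"
  have L: "L \<in> carrier_mat N d" by (rule carrier_matI) (simp_all add: L_def)
  have AE: "A l \<in> ?E" if "l < N" for l using A that by (auto simp: bij_betw_def)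
  have row_L: "row L l = x (A l)" if "l < N" for l
    using that x(1)[OF AE] by (simp add: L_def)
  have LU: "L *\<^sub>v (U *\<^sub>v ?mv X) = ?mv X" for X
    using L row_L x(2)[OF AE] by (intro eq_vecI) (auto simp: monomial_vec_def)
  have "L * U = 1\<^sub>m N"
    using L U LU by (intro mat_eq_on_GL_monomials[OF n A, of _ N]) auto
  moreover have "U * L = 1\<^sub>m d"
  proof (rule eq_rowI)
    fix i assume "i < dim_row (1\<^sub>m d :: complex mat)"
    then have i: "i < d" by simp
    have "row (U * L) i - unit_vec d i = 0\<^sub>v d"
    proof (rule orbit_functional_zero[OF irr v one])
      fix g assume g: "g \<in> carrier (GL n)"
      let ?w = "\<rho> g *\<^sub>v v"
      have w: "?w \<in> carrier_vec d" using car[OF g] v by auto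
      have "(U * L) *\<^sub>v ?w = ?w" using U L LU by (simp add: orbit[OF g])
      then have "row (U * L) i \<bullet> ?w = ?w $ i"
        using U i by (metis carrier_matD(1) index_mult_mat(2) index_mult_mat_vec)
      then show "(row (U * L) i - unit_vec d i) \<bullet> ?w = 0"
        using U L i w by (subst minus_scalar_prod_distrib[of _ d]) auto
    qed (use U L i in auto)
    moreover have "row (U * L) i = (row (U * L) i - unit_vec d i) + unit_vec d i"
      using U L by (intro eq_vecI) auto
    ultimately show "row (U * L) i = row (1\<^sub>m d) i" using i by auto
  qed (use U L in auto)
  ultimately show ?thesis
    using that A U L equi unfolding monomial_model_def by blast
qed

section \<open>Tensor products\<close>

lemma mult_add_less:
  fixes i j m n :: nat
  assumes "i < m" "j < n"
  shows "i * n + j < m * n"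
proof -
  have "i * n + j < Suc i * n" using assms by simp
  also have "\<dots> \<le> m * n" using assms by (intro mult_le_mono1) simp
  finally show ?thesis .
qed

lemma div_mod_less:
  fixes k :: nat assumes "k < m * n" shows "k div n < m" "k mod n < n"
  using assms by (auto simp: less_mult_imp_div_less intro!: mod_less_divisor gr0I)

lemma sum_div_mod:
  fixes f :: "nat \<Rightarrow> nat \<Rightarrow> 'a::comm_monoid_add"
  shows "(\<Sum>k<m * n. f (k div n) (k mod n)) = (\<Sum>i<m. \<Sum>j<n. f i j)"
proof -
  have "(\<Sum>k<m * n. f (k div n) (k mod n)) = (\<Sum>(i, j)\<in>{..<m} \<times> {..<n}. f i j)"
    by (rule sum.reindex_bij_witness[where i = "\<lambda>(i, j). i * n + j" and j = "\<lambda>k. (k div n, k mod n)"])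
      (auto simp: div_mod_less intro: mult_add_less)
  then show ?thesis by (simp add: sum.cartesian_product)
qed

lemma kronecker_carrier [simp]:
  "A \<in> carrier_mat m n \<Longrightarrow> B \<in> carrier_mat p q \<Longrightarrow> kronecker A B \<in> carrier_mat (m * p) (n * q)"
  by (auto simp: kronecker_def)

lemma kronecker_index:
  assumes "A \<in> carrier_mat m n" "B \<in> carrier_mat p q" "i < m * p" "j < n * q"
  shows "kronecker A B $$ (i, j) = A $$ (i div p, j div q) * B $$ (i mod p, j mod q)"
  using assms by (auto simp: kronecker_def)

lemma kronecker_mult:
  assumes A: "A \<in> carrier_mat m n" "C \<in> carrier_mat n l" and B: "B \<in> carrier_mat p q" "D \<in> carrier_mat q s"
  shows "kronecker A B * kronecker C D = kronecker (A * C) (B * D)"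
proof (rule eq_matI)
  fix i j assume "i < dim_row (kronecker (A * C) (B * D))" "j < dim_col (kronecker (A * C) (B * D))"
  then have ij: "i < m * p" "j < l * s" using A B by (auto simp: kronecker_def)
  have "(kronecker A B * kronecker C D) $$ (i, j) = (\<Sum>k<n * q. kronecker A B $$ (i, k) * kronecker C D $$ (k, j))"
    using A B ij by (intro index_mult_sum) auto
  also have "\<dots> = (\<Sum>k<n * q. (A $$ (i div p, k div q) * B $$ (i mod p, k mod q)) *
      (C $$ (k div q, j div s) * D $$ (k mod q, j mod s)))"
    using ij by (intro sum.cong) (auto simp: kronecker_index[OF A(1) B(1)] kronecker_index[OF A(2) B(2)])
  also have "\<dots> = (\<Sum>u<n. \<Sum>w<q. (A $$ (i div p, u) * B $$ (i mod p, w)) * (C $$ (u, j div s) * D $$ (w, j mod s)))"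
    by (rule sum_div_mod)
  also have "\<dots> = (\<Sum>u<n. A $$ (i div p, u) * C $$ (u, j div s)) * (\<Sum>w<q. B $$ (i mod p, w) * D $$ (w, j mod s))"
    by (simp add: sum_product ac_simps)
  also have "\<dots> = kronecker (A * C) (B * D) $$ (i, j)"
    using A B ij div_mod_less[OF ij(1)] div_mod_less[OF ij(2)]
    by (subst kronecker_index[of _ m l _ p s]) (auto simp del: index_mult_mat simp add: index_mult_sum)
  finally show "(kronecker A B * kronecker C D) $$ (i, j) = kronecker (A * C) (B * D) $$ (i, j)" .
qed (use A B in \<open>auto simp: kronecker_def\<close>)

lemma kronecker_one: "kronecker (1\<^sub>m m) (1\<^sub>m n) = 1\<^sub>m (m * n)"
proof (rule eq_matI)
  fix i j assume "i < dim_row (1\<^sub>m (m * n) :: complex mat)" "j < dim_col (1\<^sub>m (m * n) :: complex mat)"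
  then have ij: "i < m * n" "j < m * n" by auto
  have "i = j" if "i div n = j div n" "i mod n = j mod n"
    using that by (metis div_mult_mod_eq)
  then show "kronecker (1\<^sub>m m) (1\<^sub>m n) $$ (i, j) = 1\<^sub>m (m * n) $$ (i, j)"
    using ij div_mod_less[OF ij(1)] div_mod_less[OF ij(2)]
    by (subst kronecker_index[of _ m m _ n n]) auto
qed (auto simp: kronecker_def)

lemma kronecker_mult_vec:
  assumes A: "A \<in> carrier_mat m n" and B: "B \<in> carrier_mat p q"
    and x: "x \<in> carrier_vec n" and y: "y \<in> carrier_vec q"
  shows "kronecker A B *\<^sub>v vec (n * q) (\<lambda>k. x $ (k div q) * y $ (k mod q))
    = vec (m * p) (\<lambda>k. (A *\<^sub>v x) $ (k div p) * (B *\<^sub>v y) $ (k mod p))"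
proof (rule eq_vecI)
  fix i assume "i < dim_vec (vec (m * p) (\<lambda>k. (A *\<^sub>v x) $ (k div p) * (B *\<^sub>v y) $ (k mod p)))"
  then have i: "i < m * p" by simp
  have mv: "(M *\<^sub>v z) $ k = (\<Sum>l<c. M $$ (k, l) * z $ l)"
    if "M \<in> carrier_mat r c" "z \<in> carrier_vec c" "k < r" for M :: "complex mat" and z r c k
    using that by (auto simp: scalar_prod_def atLeast0LessThan intro!: sum.cong)
  have "(kronecker A B *\<^sub>v vec (n * q) (\<lambda>k. x $ (k div q) * y $ (k mod q))) $ i
    = (\<Sum>k<n * q. (A $$ (i div p, k div q) * B $$ (i mod p, k mod q)) * (x $ (k div q) * y $ (k mod q)))"
    using i by (subst mv[OF kronecker_carrier[OF A B]]) (auto simp: kronecker_index[OF A B] intro!: sum.cong)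
  also have "\<dots> = (\<Sum>u<n. \<Sum>w<q. (A $$ (i div p, u) * B $$ (i mod p, w)) * (x $ u * y $ w))"
    by (rule sum_div_mod)
  also have "\<dots> = (\<Sum>u<n. A $$ (i div p, u) * x $ u) * (\<Sum>w<q. B $$ (i mod p, w) * y $ w)"
    by (simp add: sum_product ac_simps)
  also have "\<dots> = (A *\<^sub>v x) $ (i div p) * (B *\<^sub>v y) $ (i mod p)"
    using mv[OF A x] mv[OF B y] div_mod_less[OF i] by simp
  finally show "(kronecker A B *\<^sub>v vec (n * q) (\<lambda>k. x $ (k div q) * y $ (k mod q))) $ i
    = vec (m * p) (\<lambda>k. (A *\<^sub>v x) $ (k div p) * (B *\<^sub>v y) $ (k mod p)) $ i" using i by simp
qed (use A B in \<open>auto simp: kronecker_def\<close>)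

lemma tensor_rep_0: "tensor_rep 0 \<rho> g = 1\<^sub>m 1"
  by (simp add: tensor_rep_def)

lemma tensor_rep_Suc: "tensor_rep (Suc r) \<rho> g = kronecker (\<rho> 0 g) (tensor_rep r (\<lambda>i. \<rho> (Suc i)) g)"
proof -
  have "map (\<lambda>i. \<rho> i g) [0..<Suc r] = \<rho> 0 g # map (\<lambda>i. \<rho> (Suc i) g) [0..<r]"
    by (simp add: upt_conv_Cons map_Suc_upt[symmetric] o_def del: upt_Suc)
  then show ?thesis by (simp only: tensor_rep_def foldr.simps list.map o_def)
qed

lemma GL_repI:
  assumes "\<And>g. g \<in> carrier (GL n) \<Longrightarrow> \<rho> g \<in> carrier_mat d d"
    and "\<And>g h. g \<in> carrier (GL n) \<Longrightarrow> h \<in> carrier (GL n) \<Longrightarrow> \<rho> (g * h) = \<rho> g * \<rho> h"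
    and one: "\<rho> (1\<^sub>m n) = 1\<^sub>m d"
  shows "GL_rep n d \<rho>"
proof -
  have "\<rho> g \<in> carrier (GL d)" if g: "g \<in> carrier (GL n)" for g
  proof -
    obtain h where h: "h \<in> carrier_mat n n" "h * g = 1\<^sub>m n" "g * h = 1\<^sub>m n" 
      using g by (auto simp: carrier_GL)
    have hG: "h \<in> carrier (GL n)" using h GL_carrier_mat[OF g] by (auto simp: carrier_GL)
    have "\<rho> h * \<rho> g = 1\<^sub>m d" "\<rho> g * \<rho> h = 1\<^sub>m d"
      using assms(2)[OF hG g] assms(2)[OF g hG] h one by auto
    then show ?thesis using assms(1)[OF g] assms(1)[OF hG] by (auto simp: carrier_GL)
  qed
  then show ?thesis using assms(2) by (auto simp: GL_rep_def hom_def)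
qed

lemma group_GL: "group (GL n)"
proof -
  interpret ring "ring_mat TYPE(complex) n ()" by (rule ring_mat)
  show ?thesis by (rule units_group)
qed

lemma GL_rep_one: "GL_rep n d \<rho> \<Longrightarrow> \<rho> (1\<^sub>m n) = 1\<^sub>m d"
  using hom_one[of \<rho> "GL n" "GL d"] group_GL by (simp add: GL_rep_def units_of_def ring_mat_simps)

lemma tensor_rep_GL_rep:
  assumes "\<And>i. i < r \<Longrightarrow> GL_rep n (d i) (\<rho> i)"
  shows "GL_rep n (\<Prod>i<r. d i) (tensor_rep r \<rho>)"
  using assms
proof (induction r arbitrary: \<rho> d)
  case 0
  show ?case by (intro GL_repI) (auto simp: tensor_rep_0)
next
  case (Suc r)
  let ?\<tau> = "tensor_rep r (\<lambda>i. \<rho> (Suc i))" and ?D = "\<Prod>i<r. d (Suc i)"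
  have 0: "GL_rep n (d 0) (\<rho> 0)" using Suc.prems by simp
  have \<tau>: "GL_rep n ?D ?\<tau>" using Suc.IH[of "\<lambda>i. d (Suc i)" "\<lambda>i. \<rho> (Suc i)"] Suc.prems by simp
  note car = GL_rep_carrier[OF 0] GL_rep_carrier[OF \<tau>]
  show ?case unfolding prod.lessThan_Suc_shift
  proof (rule GL_repI)
    fix g h assume gh: "g \<in> carrier (GL n)" "h \<in> carrier (GL n)"
    show "tensor_rep (Suc r) \<rho> (g * h) = tensor_rep (Suc r) \<rho> g * tensor_rep (Suc r) \<rho> h"
      unfolding tensor_rep_Suc GL_rep_mult[OF 0 gh] GL_rep_mult[OF \<tau> gh]
      by (rule kronecker_mult[symmetric, OF car(1)[OF gh(1)] car(1)[OF gh(2)] car(2)[OF gh(1)] car(2)[OF gh(2)]])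
  qed (auto simp: tensor_rep_Suc kronecker_carrier car GL_rep_one[OF 0] GL_rep_one[OF \<tau>] kronecker_one)
qed

lemma tensor_rep_poly_fun:
  assumes "\<And>i. i < r \<Longrightarrow> GL_rep n (d i) (\<rho> i)"
    and "\<And>i k l. i < r \<Longrightarrow> k < d i \<Longrightarrow> l < d i \<Longrightarrow> poly_fun n (\<lambda>g. \<rho> i g $$ (k, l))"
    and "k < (\<Prod>i<r. d i)" "l < (\<Prod>i<r. d i)"
  shows "poly_fun n (\<lambda>g. tensor_rep r \<rho> g $$ (k, l))"
  using assms
proof (induction r arbitrary: \<rho> d k l)
  case 0
  then show ?case by (simp add: tensor_rep_0 poly_fun_one)
next
  case (Suc r)
  let ?\<tau> = "tensor_rep r (\<lambda>i. \<rho> (Suc i))" and ?D = "\<Prod>i<r. d (Suc i)"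
  have kl: "k < d 0 * ?D" "l < d 0 * ?D" using Suc.prems(3,4) unfolding prod.lessThan_Suc_shift .
  have \<tau>: "GL_rep n ?D ?\<tau>" using Suc.prems(1) by (intro tensor_rep_GL_rep) auto
  have 0: "GL_rep n (d 0) (\<rho> 0)" using Suc.prems by simp
  have "poly_fun n (\<lambda>g. \<rho> 0 g $$ (k div ?D, l div ?D) * ?\<tau> g $$ (k mod ?D, l mod ?D))"
    using div_mod_less[OF kl(1)] div_mod_less[OF kl(2)] Suc.prems(1,2)
    by (intro poly_fun_mult Suc.IH[of "\<lambda>i. d (Suc i)" "\<lambda>i. \<rho> (Suc i)"]) auto
  moreover have "tensor_rep (Suc r) \<rho> g $$ (k, l) = \<rho> 0 g $$ (k div ?D, l div ?D) * ?\<tau> g $$ (k mod ?D, l mod ?D)"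
    if "g \<in> carrier (GL n)" for g
    unfolding tensor_rep_Suc
    using kl GL_rep_carrier[OF 0 that] GL_rep_carrier[OF \<tau> that] by (intro kronecker_index)
  ultimately show ?case unfolding poly_fun_def by auto
qed

lemma monomial_cons:
  "monomial n (Suc r) (\<lambda>p i. case i of 0 \<Rightarrow> u p 0 | Suc i \<Rightarrow> w p i) X
    = monomial n 1 u X * monomial n r w (\<lambda>p i. X p (Suc i))"
  unfolding monomial_def prod.lessThan_Suc_shift prod.distrib by simp

lemma exponents_cons_bij:
  "bij_betw (\<lambda>(u, w) p i. case i of 0 \<Rightarrow> u p 0 | Suc i \<Rightarrow> w p i)
    (exponents n 1 (\<lambda>_. a 0) \<times> exponents n r (\<lambda>i. a (Suc i))) (exponents n (Suc r) a)"
  (is "bij_betw ?F _ _")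
proof (rule bij_betwI[where g = "\<lambda>m. (\<lambda>p i. if i = 0 then m p 0 else 0, \<lambda>p i. m p (Suc i))"])
  show "?F \<in> exponents n 1 (\<lambda>_. a 0) \<times> exponents n r (\<lambda>i. a (Suc i)) \<rightarrow> exponents n (Suc r) a"
    by (auto simp: exponents_def less_Suc_eq_0_disj split: nat.splits)
  show "(\<lambda>m. (\<lambda>p i. if i = 0 then m p 0 else 0, \<lambda>p i. m p (Suc i)))
    \<in> exponents n (Suc r) a \<rightarrow> exponents n 1 (\<lambda>_. a 0) \<times> exponents n r (\<lambda>i. a (Suc i))"
    by (auto simp: exponents_def)
qed (auto simp: exponents_def fun_eq_iff split: nat.splits)

lemma bij_betw_div_mod:
  "bij_betw (\<lambda>k. (k div n, k mod n)) {..<m * n} ({..<m} \<times> {..<n :: nat})"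
  by (rule bij_betwI[where g = "\<lambda>(i, j). i * n + j"])
    (auto simp: div_mod_less intro: mult_add_less)

text \<open>The monomials in \<open>r + 1\<close> columns are the products of the monomials in the first column with
  those in the other columns, and a Kronecker product acts on the vectors of such products
  factorwise.\<close>

lemma tensor_rep_monomial_model:
  assumes "\<And>i. i < r \<Longrightarrow> F_rep n (a i) (d i) (\<rho> i)" and n: "n \<ge> 1"
  shows "\<exists>N A U L. monomial_model n r a (\<Prod>i<r. d i) (tensor_rep r \<rho>) N A U L"
  using assms(1)
proof (induction r arbitrary: \<rho> d a)
  case 0
  have "exponents n 0 a = {\<lambda>_ _. 0}" by (auto simp: exponents_def)
  then have "monomial_model n 0 a (\<Prod>i<0. d i) (tensor_rep 0 \<rho>) 1 (\<lambda>_ _ _. 0) (1\<^sub>m 1) (1\<^sub>m 1)"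
    by (auto simp: monomial_model_def tensor_rep_0 bij_betw_def inj_on_def monomial_vec_def monomial_def)
  then show ?case by blast
next
  case (Suc r)
  let ?\<tau> = "tensor_rep r (\<lambda>i. \<rho> (Suc i))" and ?D = "\<Prod>i<r. d (Suc i)"
  have F: "F_rep n (a 0) (d 0) (\<rho> 0)" using Suc.prems by simp
  have rep0: "GL_rep n (d 0) (\<rho> 0)" using F by (simp add: F_rep_def irreducible_rep_def)
  have rep1: "GL_rep n ?D ?\<tau>"
    using Suc.prems by (intro tensor_rep_GL_rep) (auto simp: F_rep_def irreducible_rep_def)
  obtain N0 A0 U0 L0 where "monomial_model n 1 (\<lambda>_. a 0) (d 0) (\<rho> 0) N0 A0 U0 L0"
    using F_rep_monomial_model[OF F n] by blast
  then have bij0: "bij_betw A0 {..<N0} (exponents n 1 (\<lambda>_. a 0))"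
    and U0: "U0 \<in> carrier_mat (d 0) N0" "L0 \<in> carrier_mat N0 (d 0)" "U0 * L0 = 1\<^sub>m (d 0)" "L0 * U0 = 1\<^sub>m N0"
    and e0: "\<And>g X. g \<in> carrier (GL n) \<Longrightarrow> \<rho> 0 g *\<^sub>v (U0 *\<^sub>v monomial_vec n 1 A0 N0 X) = U0 *\<^sub>v monomial_vec n 1 A0 N0 (act n g X)"
    unfolding monomial_model_def by blast+
  obtain N1 A1 U1 L1 where "monomial_model n r (\<lambda>i. a (Suc i)) ?D ?\<tau> N1 A1 U1 L1"
    using Suc.IH[of "\<lambda>i. a (Suc i)" "\<lambda>i. d (Suc i)" "\<lambda>i. \<rho> (Suc i)"] Suc.prems by auto
  then have bij1: "bij_betw A1 {..<N1} (exponents n r (\<lambda>i. a (Suc i)))"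
    and U1: "U1 \<in> carrier_mat ?D N1" "L1 \<in> carrier_mat N1 ?D" "U1 * L1 = 1\<^sub>m ?D" "L1 * U1 = 1\<^sub>m N1"
    and e1: "\<And>g X. g \<in> carrier (GL n) \<Longrightarrow> ?\<tau> g *\<^sub>v (U1 *\<^sub>v monomial_vec n r A1 N1 X) = U1 *\<^sub>v monomial_vec n r A1 N1 (act n g X)"
    unfolding monomial_model_def by blast+
  let ?N = "N0 * N1" and ?U = "kronecker U0 U1" and ?L = "kronecker L0 L1"
  let ?A = "\<lambda>k p i. case i of 0 \<Rightarrow> A0 (k div N1) p 0 | Suc i \<Rightarrow> A1 (k mod N1) p i"
  let ?mv = "monomial_vec n (Suc r) ?A ?N"
  let ?X1 = "\<lambda>X p i. X p (Suc i) :: complex"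
  have bij: "bij_betw ?A {..<?N} (exponents n (Suc r) a)"
  proof -
    have "bij_betw (map_prod A0 A1) ({..<N0} \<times> {..<N1}) (exponents n 1 (\<lambda>_. a 0) \<times> exponents n r (\<lambda>i. a (Suc i)))"
      using bij0 bij1 by (rule bij_betw_map_prod)
    from bij_betw_trans[OF bij_betw_trans[OF bij_betw_div_mod this] exponents_cons_bij]
    show ?thesis by (simp add: o_def)
  qed
  have mv: "?mv X = vec ?N (\<lambda>k. monomial_vec n 1 A0 N0 X $ (k div N1) * monomial_vec n r A1 N1 (?X1 X) $ (k mod N1))" for X
    by (rule eq_vecI) (auto simp: monomial_vec_def div_mod_less monomial_cons)
  have Umv: "?U *\<^sub>v ?mv X = vec (d 0 * ?D) (\<lambda>k. (U0 *\<^sub>v monomial_vec n 1 A0 N0 X) $ (k div ?D) *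
      (U1 *\<^sub>v monomial_vec n r A1 N1 (?X1 X)) $ (k mod ?D))" for X
    unfolding mv by (rule kronecker_mult_vec) (use U0 U1 in auto)
  have "monomial_model n (Suc r) a (d 0 * ?D) (tensor_rep (Suc r) \<rho>) ?N ?A ?U ?L"
    unfolding monomial_model_def
  proof (intro conjI ballI allI)
    fix g X assume g: "g \<in> carrier (GL n)"
    have "tensor_rep (Suc r) \<rho> g *\<^sub>v (?U *\<^sub>v ?mv X)
      = vec (d 0 * ?D) (\<lambda>k. (\<rho> 0 g *\<^sub>v (U0 *\<^sub>v monomial_vec n 1 A0 N0 X)) $ (k div ?D) *
      (?\<tau> g *\<^sub>v (U1 *\<^sub>v monomial_vec n r A1 N1 (?X1 X))) $ (k mod ?D))"
      unfolding Umv tensor_rep_Suc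
      by (rule kronecker_mult_vec[OF GL_rep_carrier[OF rep0 g] GL_rep_carrier[OF rep1 g]]) (use U0 U1 in auto)
    also have "\<dots> = ?U *\<^sub>v ?mv (act n g X)"
      unfolding Umv e0[OF g] e1[OF g] by (simp add: act_def[abs_def])
    finally show "tensor_rep (Suc r) \<rho> g *\<^sub>v (?U *\<^sub>v ?mv X) = ?U *\<^sub>v ?mv (act n g X)" .
  next
    show "?U * ?L = 1\<^sub>m (d 0 * ?D)" "?L * ?U = 1\<^sub>m ?N"
      using U0 U1 by (simp_all add: kronecker_mult[of _ _ _ _ _ _ _ _ _ ] kronecker_one)
  qed (use bij U0 U1 in auto)
  then show ?case unfolding prod.lessThan_Suc_shift by blast
qed

section \<open>Homomorphisms and contingency tables\<close>

text \<open>The inverse of the coordinate map is an injective linear map from the space of column vectors,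
  whose dimension is known, with image \<open>H\<close>; the dimension then follows from the rank-nullity
  theorem.\<close>

lemma dim_by_coordinates:
  assumes sub: "VectorSpace.subspace class_ring H (module_mat TYPE(complex) e d)"
    and bij: "bij_betw \<phi> H (carrier_vec K)"
    and add: "\<And>S T. S \<in> H \<Longrightarrow> T \<in> H \<Longrightarrow> \<phi> (S + T) = \<phi> S + \<phi> T"
    and smult: "\<And>c T. T \<in> H \<Longrightarrow> \<phi> (c \<cdot>\<^sub>m T) = c \<cdot>\<^sub>v \<phi> T"
  shows "vectorspace.dim class_ring ((module_mat TYPE(complex) e d)\<lparr>carrier := H\<rparr>) = K"
proof -
  let ?M = "module_mat TYPE(complex) e d" and ?V = "module_vec TYPE(complex) K"
  interpret V: vec_space "TYPE(complex)" K .
  interpret M: vectorspace class_ring ?M by (rule matrix_vs)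
  have "submodule class_ring H ?M" using sub by (simp add: VectorSpace.subspace_def)
  then have H: "H \<subseteq> carrier_mat e d" "0\<^sub>m e d \<in> H"
    "\<And>S T. S \<in> H \<Longrightarrow> T \<in> H \<Longrightarrow> S + T \<in> H" "\<And>c T. T \<in> H \<Longrightarrow> c \<cdot>\<^sub>m T \<in> H"
    unfolding submodule_def by (auto simp: module_mat_simps)
  define \<psi> where "\<psi> = inv_into H \<phi>"
  have \<psi>: "\<psi> x \<in> H" "\<phi> (\<psi> x) = x" if "x \<in> carrier_vec K" for x
    using bij that unfolding \<psi>_def bij_betw_def by (auto intro: inv_into_into f_inv_into_f)
  have inj: "S = T" if "S \<in> H" "T \<in> H" "\<phi> S = \<phi> T" for S T
    using bij that by (auto simp: bij_betw_def inj_on_def)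
  have \<psi>_add: "\<psi> (x + y) = \<psi> x + \<psi> y" if "x \<in> carrier_vec K" "y \<in> carrier_vec K" for x y
    using that \<psi> by (intro inj H) (auto simp: add)
  have \<psi>_smult: "\<psi> (c \<cdot>\<^sub>v x) = c \<cdot>\<^sub>m \<psi> x" if "x \<in> carrier_vec K" for c x
    using that \<psi> by (intro inj H) (auto simp: smult)
  interpret T: linear_map class_ring ?V ?M \<psi>
  proof (unfold_locales, goal_cases)
    case 1
    show ?case using \<psi> \<psi>_add \<psi>_smult H unfolding LinearCombinations.module_hom_def
      by (auto simp: module_mat_simps module_vec_simps)
  qed
  have im: "T.imT = H"
  proof -
    have "\<psi> ` carrier_vec K = H" using bij_betw_inv_into[OF bij] by (simp add: \<psi>_def bij_betw_def)
    then show ?thesis by (simp add: T.im_def)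
  qed
  have "T.kerT = {0\<^sub>v K}"
  proof -
    have "x = 0\<^sub>v K" if x: "x \<in> carrier_vec K" "\<psi> x = 0\<^sub>m e d" for x
    proof -
      have "x = \<phi> (0 \<cdot>\<^sub>m \<psi> x)" using \<psi>[OF x(1)] x(2) by simp
      also have "\<dots> = 0 \<cdot>\<^sub>v x" using \<psi>[OF x(1)] by (simp only: smult)
      also have "\<dots> = 0\<^sub>v K" using x by auto
      finally show ?thesis .
    qed
    moreover have "\<psi> (0\<^sub>v K) = 0\<^sub>m e d"
    proof -
      have "\<psi> (0 \<cdot>\<^sub>v 0\<^sub>v K) = 0 \<cdot>\<^sub>m \<psi> (0\<^sub>v K)" by (intro \<psi>_smult) simp
      also have "\<dots> = 0\<^sub>m e d" using \<psi>(1)[of "0\<^sub>v K"] H(1) by (intro eq_matI) auto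
      finally show ?thesis by simp
    qed
    ultimately show ?thesis by (auto simp: T.ker_def module_mat_simps)
  qed
  moreover have "vectorspace.dim class_ring (V.vs {0\<^sub>v K}) = 0"
  proof -
    have sub0: "VectorSpace.subspace class_ring {0\<^sub>v K} ?V" using T.kerT_is_subspace calculation by simp
    interpret Z: vectorspace class_ring "V.vs {0\<^sub>v K}" by (rule V.subspace_is_vs[OF sub0])
    have "Z.span {} = {0\<^sub>v K}" by (simp add: Z.span_def Z.lincomb_def)
    then have "Z.dim \<le> card ({} :: complex vec set)" by (intro Z.gen_ge_dim) auto
    then show ?thesis by simp
  qed
  ultimately show ?thesis using T.rank_nullity V.fin_dim im V.dim_is_n by simp
qed

text \<open>In the basis of a model the torus acts diagonally, and the weights are the row sums of the
  exponents: compare the coefficients in \<open>\<sigma> (diag n t) (U Y\<^sup>B) = U (t Y)\<^sup>B\<close>.\<close>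

lemma torus_on_model:
  assumes sn: "s \<le> n" and mod: "monomial_model n s b e \<sigma> N B U L" and rep: "GL_rep n e \<sigma>"
    and t: "\<forall>j. t j \<noteq> 0" and y: "y \<in> carrier_vec N"
  shows "\<sigma> (diag n t) *\<^sub>v (U *\<^sub>v y) = U *\<^sub>v vec N (\<lambda>k. (\<Prod>p<n. t p ^ (\<Sum>i<s. B k p i)) * y $ k)"
proof -
  have B: "bij_betw B {..<N} (exponents n s b)" and U: "U \<in> carrier_mat e N"
    and equi: "\<And>g X. g \<in> carrier (GL n) \<Longrightarrow> \<sigma> g *\<^sub>v (U *\<^sub>v monomial_vec n s B N X) = U *\<^sub>v monomial_vec n s B N (act n g X)"
    using mod by (auto simp: monomial_model_def)
  have tg: "diag n t \<in> carrier (GL n)" using t by (intro diag_GL) auto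
  note car = GL_rep_carrier[OF rep tg]
  let ?D = "diag N (\<lambda>k. \<Prod>p<n. t p ^ (\<Sum>i<s. B k p i))"
  have D: "?D *\<^sub>v z = vec N (\<lambda>k. (\<Prod>p<n. t p ^ (\<Sum>i<s. B k p i)) * z $ k)" if "z \<in> carrier_vec N" for z
  proof (rule eq_vecI)
    fix k assume "k < dim_vec (vec N (\<lambda>k. (\<Prod>p<n. t p ^ (\<Sum>i<s. B k p i)) * z $ k))"
    then have k: "k < N" by simp
    have "(?D *\<^sub>v z) $ k = act N ?D (\<lambda>p i. z $ p) k 0"
      using k that by (auto simp: act_def scalar_prod_def diag_def atLeast0LessThan intro!: sum.cong)
    then show "(?D *\<^sub>v z) $ k = vec N (\<lambda>k. (\<Prod>p<n. t p ^ (\<Sum>i<s. B k p i)) * z $ k) $ k"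
      using k by (simp add: act_diag)
  qed (simp add: diag_def)
  have mv: "monomial_vec n s B N (act n (diag n t) X) = ?D *\<^sub>v monomial_vec n s B N X" for X
  proof -
    have "monomial_vec n s B N (act n (diag n t) X) = monomial_vec n s B N (\<lambda>p i. t p * X p i)"
      by (intro monomial_vec_cong act_diag)
    then show ?thesis unfolding D[OF monomial_vec_carrier] by (auto simp: monomial_vec_def monomial_scale_rows)
  qed
  have "\<sigma> (diag n t) * U = U * ?D"
  proof (rule mat_eq_on_GL_monomials[OF sn B, of _ e])
    fix g :: "complex mat"
    let ?x = "monomial_vec n s B N (entries g)"
    have "(\<sigma> (diag n t) * U) *\<^sub>v ?x = \<sigma> (diag n t) *\<^sub>v (U *\<^sub>v ?x)" using car U by simp
    also have "\<dots> = U *\<^sub>v (?D *\<^sub>v ?x)" unfolding equi[OF tg] mv ..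
    also have "\<dots> = (U * ?D) *\<^sub>v ?x" by (rule assoc_mult_mat_vec[symmetric, OF U diag_carrier monomial_vec_carrier])
    finally show "(\<sigma> (diag n t) * U) *\<^sub>v ?x = (U * ?D) *\<^sub>v ?x" .
  qed (use car U mult_carrier_mat[OF U diag_carrier] in auto)
  then have "\<sigma> (diag n t) *\<^sub>v (U *\<^sub>v y) = U *\<^sub>v (?D *\<^sub>v y)"
    using assoc_mult_mat_vec[OF car U y] assoc_mult_mat_vec[OF U diag_carrier y] by simp
  then show ?thesis unfolding D[OF y] .
qed

lemma row_sums_from_characters:
  fixes w u :: "nat \<Rightarrow> nat"
  assumes "\<And>t :: nat \<Rightarrow> complex. \<forall>j. t j \<noteq> 0 \<Longrightarrow> (\<Prod>p<n. t p ^ w p) = (\<Prod>p<n. t p ^ u p)" and p: "p < n"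
  shows "w p = u p"
proof -
  let ?t = "\<lambda>q. if q = p then 2 else 1 :: complex"
  have "(\<Prod>q<n. ?t q ^ x q) = 2 ^ x p" for x
  proof -
    have "(\<Prod>q<n. ?t q ^ x q) = (\<Prod>q<n. if q = p then 2 ^ x p else 1)" by (intro prod.cong) auto
    then show ?thesis using p by simp
  qed
  then have "(2::complex) ^ w p = 2 ^ u p" using assms(1)[of ?t] by simp
  then have "norm ((2::complex) ^ w p) = norm ((2::complex) ^ u p)" by simp
  then have "(2::real) ^ w p = 2 ^ u p" by (simp add: norm_power)
  then show ?thesis by simp
qed

text \<open>The exponents that index the weight space of weight \<open>(a\<^sub>0, \<dots>, a\<^bsub>r-1\<^esub>, 0, \<dots>, 0)\<close> in a model with
  column degrees \<open>b\<close>.\<close>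

definition weight_exponents :: "nat \<Rightarrow> nat \<Rightarrow> nat \<Rightarrow> (nat \<Rightarrow> nat) \<Rightarrow> (nat \<Rightarrow> nat) \<Rightarrow> (nat \<Rightarrow> nat \<Rightarrow> nat) set" where
  "weight_exponents n r s a b =
    {m \<in> exponents n s b. \<forall>p<n. (\<Sum>i<s. m p i) = (if p < r then a p else 0)}"

text \<open>The rows from \<open>r\<close> on have sum zero, hence they vanish.\<close>

lemma card_weight_exponents:
  assumes rn: "r \<le> n"
  shows "card (weight_exponents n r s a b) = card (contingency_tables r s a b)"
proof (rule bij_betw_same_card, rule bij_betwI)
  let ?f = "\<lambda>m. mat r s (\<lambda>(i, j). m i j)"
  let ?g = "\<lambda>C p j. if p < r \<and> j < s then C $$ (p, j) else 0"
  have high: "m p j = 0" if m: "m \<in> weight_exponents n r s a b" and pj: "r \<le> p \<or> s \<le> j" for m p j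
  proof (cases "p < n \<and> j < s")
    case True
    then have "(\<Sum>i<s. m p i) = 0" using m pj by (auto simp: weight_exponents_def)
    then show ?thesis using True by simp
  qed (use m in \<open>auto simp: weight_exponents_def exponents_def\<close>)
  have restrict: "(\<Sum>p<n. x p) = (\<Sum>p<r. x p)" if "\<And>p. r \<le> p \<Longrightarrow> x p = 0" for x :: "nat \<Rightarrow> nat"
    using rn that by (intro sum.mono_neutral_right) auto
  show "?f \<in> weight_exponents n r s a b \<rightarrow> contingency_tables r s a b"
  proof
    fix m assume m: "m \<in> weight_exponents n r s a b"
    have "(\<Sum>p<r. m p j) = b j" if "j < s" for j
      using restrict[of "\<lambda>p. m p j"] high[OF m] m that by (auto simp: weight_exponents_def exponents_def)
    then show "?f m \<in> contingency_tables r s a b"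
      using m rn by (auto simp: contingency_tables_def weight_exponents_def)
  qed
  show "?g \<in> contingency_tables r s a b \<rightarrow> weight_exponents n r s a b"
  proof
    fix C assume C: "C \<in> contingency_tables r s a b"
    have "(\<Sum>p<n. ?g C p j) = b j" if "j < s" for j
      using restrict[of "\<lambda>p. ?g C p j"] C that by (auto simp: contingency_tables_def)
    moreover have "(\<Sum>j<s. ?g C p j) = (if p < r then a p else 0)" for p
      using C by (auto simp: contingency_tables_def)
    ultimately show "?g C \<in> weight_exponents n r s a b"
      using rn by (auto simp: weight_exponents_def exponents_def)
  qed
  show "?g (?f m) = m" if "m \<in> weight_exponents n r s a b" for m
    using high[OF that] by (auto simp: fun_eq_iff)
  show "?f (?g C) = C" if "C \<in> contingency_tables r s a b" for C
    using that by (intro eq_matI) (auto simp: contingency_tables_def)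
qed

text \<open>Let \<open>v\<close> be the value of the equivariant map of \<open>\<rho>\<close> at the matrix formed by the first \<open>r\<close> standard
  basis vectors. A homomorphism \<open>T\<close> is determined by \<open>T v\<close>, because \<open>v\<close> generates the source, and
  \<open>T v\<close> has the weight \<open>(a\<^sub>0, \<dots>, a\<^bsub>r-1\<^esub>, 0, \<dots>, 0)\<close> of \<open>v\<close>. Conversely, if \<open>w\<close> has this weight, then the
  coordinates of \<open>\<sigma> g w\<close> are combinations of the monomials that are the coordinates of \<open>\<rho> g v\<close> in the
  model; these combinations define a matrix that sends \<open>\<rho> g v\<close> to \<open>\<sigma> g w\<close> for all \<open>g\<close>, so it is a
  homomorphism. Hence the homomorphisms correspond to the weight space, which has a basis indexed by
  \<open>weight_exponents n r s a b\<close>.\<close>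

lemma dim_Hom_GL_monomial_models:
  assumes rn: "r \<le> n" and sn: "s \<le> n"
    and rep: "GL_rep n d \<rho>" and rep': "GL_rep n e \<sigma>"
    and pf: "\<And>k l. k < e \<Longrightarrow> l < e \<Longrightarrow> poly_fun n (\<lambda>g. \<sigma> g $$ (k, l))"
    and mod: "monomial_model n r a d \<rho> N A U L" and mod': "monomial_model n s b e \<sigma> N' B U' L'"
  shows "dim_Hom_GL n d \<rho> e \<sigma> = card (weight_exponents n r s a b)"
proof -
  have A: "bij_betw A {..<N} (exponents n r a)" and U: "U \<in> carrier_mat d N" "L \<in> carrier_mat N d"
    "U * L = 1\<^sub>m d" "L * U = 1\<^sub>m N"
    and equi: "\<And>g X. g \<in> carrier (GL n) \<Longrightarrow> \<rho> g *\<^sub>v (U *\<^sub>v monomial_vec n r A N X) = U *\<^sub>v monomial_vec n r A N (act n g X)"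
    using mod by (auto simp: monomial_model_def)
  have B: "bij_betw B {..<N'} (exponents n s b)" and U': "U' \<in> carrier_mat e N'" "L' \<in> carrier_mat N' e"
    "U' * L' = 1\<^sub>m e" "L' * U' = 1\<^sub>m N'"
    using mod' by (auto simp: monomial_model_def)
  note car = GL_rep_carrier[OF rep] and car' = GL_rep_carrier[OF rep']
  let ?H = "Hom_GL n d \<rho> e \<sigma>" and ?mv = "monomial_vec n r A N"
  define v where "v = U *\<^sub>v ?mv (entries (1\<^sub>m n))"
  have v: "v \<in> carrier_vec d" using U by (simp add: v_def)
  have orbit: "\<rho> g *\<^sub>v v = U *\<^sub>v ?mv (entries g)" if g: "g \<in> carrier (GL n)" for g
  proof -
    have "?mv (act n g (entries (1\<^sub>m n))) = ?mv (entries g)"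
      using monomial_vec_act_entries[OF rn g one_GL] GL_carrier_mat[OF g] by simp
    then show ?thesis using equi[OF g] by (simp add: v_def)
  qed
  have hom_orbit: "(T * U) *\<^sub>v ?mv (entries g) = \<sigma> g *\<^sub>v (T *\<^sub>v v)" if T: "T \<in> ?H" and g: "g \<in> carrier (GL n)" for T g
  proof -
    have Tc: "T \<in> carrier_mat e d" and Tg: "T * \<rho> g = \<sigma> g * T" using T g by (auto simp: Hom_GL_def)
    have "(T * U) *\<^sub>v ?mv (entries g) = T *\<^sub>v (\<rho> g *\<^sub>v v)" using Tc U by (simp add: orbit[OF g])
    also have "\<dots> = (T * \<rho> g) *\<^sub>v v" using Tc car[OF g] v by simp
    also have "\<dots> = \<sigma> g *\<^sub>v (T *\<^sub>v v)" unfolding Tg using Tc car'[OF g] v by simp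
    finally show ?thesis .
  qed
  have right_cancel: "S = T" if "S \<in> carrier_mat q d" "T \<in> carrier_mat q d" "S * U = T * U" for S T q
  proof -
    have cancel: "M * U * L = M" if "M \<in> carrier_mat q d" for M
      unfolding assoc_mult_mat[OF that U(1,2)] U(3) by (rule right_mult_one_mat[OF that])
    have "S = T * U * L" unfolding that(3)[symmetric] by (rule cancel[OF that(1), symmetric])
    then show ?thesis unfolding cancel[OF that(2)] .
  qed
  \<comment> \<open>The coordinates of \<open>T v\<close> in the model of the target.\<close>
  define y where "y T = L' *\<^sub>v (T *\<^sub>v v)" for T
  have Uy: "U' *\<^sub>v y T = T *\<^sub>v v" if "T \<in> ?H" for T
  proof -
    have "T *\<^sub>v v \<in> carrier_vec e" using that v by (auto simp: Hom_GL_def)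
    then have "U' *\<^sub>v (L' *\<^sub>v (T *\<^sub>v v)) = (U' * L') *\<^sub>v (T *\<^sub>v v)" using U'(1,2) by simp
    then show ?thesis using U' \<open>T *\<^sub>v v \<in> carrier_vec e\<close> by (simp add: y_def)
  qed
  have y: "y T \<in> carrier_vec N'" for T using U' by (intro carrier_vecI) (simp add: y_def)
  \<comment> \<open>The basis vectors of the target that have the weight of \<open>v\<close>.\<close>
  let ?J = "{k. k < N' \<and> B k \<in> weight_exponents n r s a b}"
  let ?w = "\<lambda>p. if p < r then a p else 0"
  have w_prod: "(\<Prod>p<n. t p ^ ?w p) = (\<Prod>i<r. t i ^ a i)" for t :: "nat \<Rightarrow> complex"
    using rn by (intro prod.mono_neutral_cong_right) auto
  have J_char: "(\<Prod>p<n. t p ^ (\<Sum>i<s. B k p i)) = (\<Prod>i<r. t i ^ a i)" if "k \<in> ?J" for k and t :: "nat \<Rightarrow> complex"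
    unfolding w_prod[symmetric] using that by (intro prod.cong) (auto simp: weight_exponents_def)
  have U'_cancel: "x = z" if "x \<in> carrier_vec N'" "z \<in> carrier_vec N'" "U' *\<^sub>v x = U' *\<^sub>v z" for x z
  proof -
    have cancel: "L' *\<^sub>v (U' *\<^sub>v u) = u" if "u \<in> carrier_vec N'" for u
      unfolding assoc_mult_mat_vec[OF U'(2,1) that, symmetric] U'(4) by (rule one_mult_mat_vec[OF that])
    have "x = L' *\<^sub>v (U' *\<^sub>v z)" unfolding that(3)[symmetric] by (rule cancel[OF that(1), symmetric])
    then show ?thesis unfolding cancel[OF that(2)] .
  qed
  \<comment> \<open>\<open>T v\<close> has the weight of \<open>v\<close>, so its coordinates at basis vectors of other weights vanish.\<close>
  have support: "y T $ k = 0" if T: "T \<in> ?H" and k: "k < N'" "k \<notin> ?J" for T k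
  proof (rule ccontr)
    assume nz: "y T $ k \<noteq> 0"
    have "(\<Prod>p<n. t p ^ (\<Sum>i<s. B k p i)) = (\<Prod>p<n. t p ^ ?w p)"
      if t: "\<forall>j. t j \<noteq> 0" for t :: "nat \<Rightarrow> complex"
    proof -
      let ?c = "\<Prod>i<r. t i ^ a i"
      have tg: "diag n t \<in> carrier (GL n)" using t by (intro diag_GL) auto
      have "?mv (entries (diag n t)) = ?mv (\<lambda>p i. t i * (1\<^sub>m n) $$ (p, i))"
        using rn by (intro monomial_vec_cong) (auto simp: diag_def)
      also have "\<dots> = ?c \<cdot>\<^sub>v ?mv (entries (1\<^sub>m n))"
      proof (rule eq_vecI)
        fix l assume "l < dim_vec (?c \<cdot>\<^sub>v ?mv (entries (1\<^sub>m n)))"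
        then have l: "l < N" by (simp add: monomial_vec_def)
        then have "A l \<in> exponents n r a" using A by (auto simp: bij_betw_def)
        then have "(\<Prod>i<r. t i ^ (\<Sum>p<n. A l p i)) = ?c"
          by (intro prod.cong) (auto simp: exponents_def)
        then show "?mv (\<lambda>p i. t i * (1\<^sub>m n) $$ (p, i)) $ l = (?c \<cdot>\<^sub>v ?mv (entries (1\<^sub>m n))) $ l"
          using l by (simp add: monomial_vec_def monomial_scale_columns)
      qed (simp add: monomial_vec_def)
      finally have mvt: "?mv (entries (diag n t)) = ?c \<cdot>\<^sub>v ?mv (entries (1\<^sub>m n))" .
      have Tc: "T \<in> carrier_mat e d" using T by (simp add: Hom_GL_def)
      have "\<sigma> (diag n t) *\<^sub>v (U' *\<^sub>v y T) = (T * U) *\<^sub>v ?mv (entries (diag n t))"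
        unfolding Uy[OF T] hom_orbit[OF T tg] ..
      also have "\<dots> = ?c \<cdot>\<^sub>v ((T * U) *\<^sub>v ?mv (entries (1\<^sub>m n)))"
        unfolding mvt by (rule mult_mat_vec[OF mult_carrier_mat[OF Tc U(1)] monomial_vec_carrier])
      also have "(T * U) *\<^sub>v ?mv (entries (1\<^sub>m n)) = U' *\<^sub>v y T"
        unfolding Uy[OF T] v_def by (rule assoc_mult_mat_vec[OF Tc U(1) monomial_vec_carrier])
      also have "?c \<cdot>\<^sub>v (U' *\<^sub>v y T) = U' *\<^sub>v (?c \<cdot>\<^sub>v y T)"
        by (rule mult_mat_vec[OF U'(1) y, symmetric])
      finally have "U' *\<^sub>v vec N' (\<lambda>k. (\<Prod>p<n. t p ^ (\<Sum>i<s. B k p i)) * y T $ k) = U' *\<^sub>v (?c \<cdot>\<^sub>v y T)"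
        unfolding torus_on_model[OF sn mod' rep' t y] .
      then have "vec N' (\<lambda>k. (\<Prod>p<n. t p ^ (\<Sum>i<s. B k p i)) * y T $ k) = ?c \<cdot>\<^sub>v y T"
        by (rule U'_cancel[OF vec_carrier iffD2[OF smult_carrier_vec y]])
      from arg_cong[OF this, of "\<lambda>x. x $ k"] show ?thesis
        unfolding w_prod using nz k y[of T] by simp
    qed
    from row_sums_from_characters[OF this] have "B k \<in> weight_exponents n r s a b"
      using B k by (auto simp: weight_exponents_def bij_betw_def)
    with k show False by simp
  qed
  have ex_hom: "\<exists>T\<in>?H. y T = z" if z: "z \<in> carrier_vec N'" "\<And>k. k < N' \<Longrightarrow> k \<notin> ?J \<Longrightarrow> z $ k = 0" for z
  proof -
    have Uz: "U' *\<^sub>v z \<in> carrier_vec e" using U' z by simp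
    have wt: "\<sigma> (diag n t) *\<^sub>v (U' *\<^sub>v z) = (\<Prod>i<r. t i ^ a i) \<cdot>\<^sub>v (U' *\<^sub>v z)" if t: "\<forall>j. t j \<noteq> 0" for t
    proof -
      have "vec N' (\<lambda>k. (\<Prod>p<n. t p ^ (\<Sum>i<s. B k p i)) * z $ k) = (\<Prod>i<r. t i ^ a i) \<cdot>\<^sub>v z"
      proof (rule eq_vecI)
        fix k assume "k < dim_vec ((\<Prod>i<r. t i ^ a i) \<cdot>\<^sub>v z)"
        then have k: "k < N'" using z by simp
        then show "vec N' (\<lambda>k. (\<Prod>p<n. t p ^ (\<Sum>i<s. B k p i)) * z $ k) $ k = ((\<Prod>i<r. t i ^ a i) \<cdot>\<^sub>v z) $ k"
          using z J_char[of k] by (cases "k \<in> ?J") auto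
      qed (use z in auto)
      then show ?thesis unfolding torus_on_model[OF sn mod' rep' t z(1)] mult_mat_vec[OF U'(1) z(1), symmetric] by simp
    qed
    obtain C where C: "C \<in> carrier_mat e N"
      and orb: "\<And>g. g \<in> carrier (GL n) \<Longrightarrow> \<sigma> g *\<^sub>v (U' *\<^sub>v z) = C *\<^sub>v ?mv (entries g)"
      using weight_vector_orbit[OF rn rep' pf Uz wt A] by blast
    \<comment> \<open>\<open>L\<close> turns \<open>\<rho> g v\<close> into the monomials in \<open>g\<close>, and \<open>C\<close> turns these into \<open>\<sigma> g (U' z)\<close>.\<close>
    let ?T = "C * L"
    have Tc: "?T \<in> carrier_mat e d" using C U by simp
    have TU: "?T * U = C" using C U by (simp add: assoc_mult_mat[of _ e N _ d _ N])
    have "?T * \<rho> h = \<sigma> h * ?T" if h: "h \<in> carrier (GL n)" for h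
    proof (rule right_cancel)
      show "?T * \<rho> h * U = \<sigma> h * ?T * U"
      proof (rule mat_eq_on_GL_monomials[OF rn A, of _ e])
        fix g assume g: "g \<in> carrier (GL n)"
        have "(?T * \<rho> h * U) *\<^sub>v ?mv (entries g) = ?T *\<^sub>v (\<rho> h *\<^sub>v (U *\<^sub>v ?mv (entries g)))"
          using Tc car[OF h] U(1) by (simp add: assoc_mult_mat_vec[of _ e d] del: assoc_mult_mat)
        also have "\<dots> = ?T *\<^sub>v (U *\<^sub>v ?mv (entries (h * g)))"
          unfolding equi[OF h] monomial_vec_act_entries[OF rn h g] ..
        also have "\<dots> = (?T * U) *\<^sub>v ?mv (entries (h * g))" using Tc U(1) by simp
        also have "\<dots> = \<sigma> h *\<^sub>v (\<sigma> g *\<^sub>v (U' *\<^sub>v z))"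
          unfolding TU orb[OF GL_mult_closed[OF h g], symmetric] GL_rep_mult[OF rep' h g]
          using car'[OF h] car'[OF g] Uz by simp
        also have "\<dots> = (\<sigma> h * (?T * U)) *\<^sub>v ?mv (entries g)"
          unfolding TU orb[OF g] using car'[OF h] C by simp
        also have "\<sigma> h * (?T * U) = \<sigma> h * ?T * U"
          by (rule assoc_mult_mat[symmetric, OF car'[OF h] Tc U(1)])
        finally show "(?T * \<rho> h * U) *\<^sub>v ?mv (entries g) = (\<sigma> h * ?T * U) *\<^sub>v ?mv (entries g)" .
      qed (use Tc car[OF h] car'[OF h] U(1) in auto)
    qed (rule mult_carrier_mat[OF Tc car[OF h]] mult_carrier_mat[OF car'[OF h] Tc])+
    then have TH: "?T \<in> ?H" using Tc by (auto simp: Hom_GL_def)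
    have "U' *\<^sub>v y ?T = \<sigma> (1\<^sub>m n) *\<^sub>v (?T *\<^sub>v v)"
      using Uy[OF TH] GL_rep_one[OF rep'] Tc v by simp
    also have "\<dots> = U' *\<^sub>v z"
      using hom_orbit[OF TH one_GL] orb[OF one_GL] GL_rep_one[OF rep'] Uz by (simp add: TU)
    finally have "y ?T = z" by (rule U'_cancel[OF y z(1)])
    then show ?thesis using TH by blast
  qed
  let ?K = "card ?J"
  obtain j where j: "bij_betw j {..<?K} ?J"
    using ex_bij_betw_nat_finite[of ?J] unfolding atLeast0LessThan by auto
  define \<phi> where "\<phi> T = vec ?K (\<lambda>l. y T $ j l)" for T
  have j_less: "j l \<in> ?J" if "l < ?K" for l using j that unfolding bij_betw_def by blast
  have "vectorspace.dim class_ring ((module_mat TYPE(complex) e d)\<lparr>carrier := ?H\<rparr>) = ?K"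
  proof (rule dim_by_coordinates[OF subspace_Hom_GL[OF rep rep']])
    have Hc: "T \<in> carrier_mat e d" if "T \<in> ?H" for T using that by (simp add: Hom_GL_def)
    have Tv: "T *\<^sub>v v \<in> carrier_vec e" if "T \<in> ?H" for T
      by (rule mult_mat_vec_carrier[OF Hc[OF that] v])
    show "\<phi> (S + T) = \<phi> S + \<phi> T" if "S \<in> ?H" "T \<in> ?H" for S T
    proof -
      have "y (S + T) = y S + y T"
        unfolding y_def add_mult_distrib_mat_vec[OF Hc[OF that(1)] Hc[OF that(2)] v]
        by (rule mult_add_distrib_mat_vec[OF U'(2) Tv[OF that(1)] Tv[OF that(2)]])
      then show ?thesis using y j_less by (auto simp: \<phi>_def carrier_vecD[OF y])
    qed
    show "\<phi> (c \<cdot>\<^sub>m T) = c \<cdot>\<^sub>v \<phi> T" if "T \<in> ?H" for c T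
    proof -
      have "y (c \<cdot>\<^sub>m T) = c \<cdot>\<^sub>v y T"
      proof -
        have "(c \<cdot>\<^sub>m T) *\<^sub>v v = c \<cdot>\<^sub>v (T *\<^sub>v v)" using Hc[OF that] v by (intro eq_vecI) auto
        then show ?thesis unfolding y_def using mult_mat_vec[OF U'(2) Tv[OF that]] by simp
      qed
      then show ?thesis using y j_less by (auto simp: \<phi>_def carrier_vecD[OF y])
    qed
    show "bij_betw \<phi> ?H (carrier_vec ?K)"
      unfolding bij_betw_def
    proof (intro conjI inj_onI equalityI subsetI)
      fix S T assume ST: "S \<in> ?H" "T \<in> ?H" "\<phi> S = \<phi> T"
      have "y S $ k = y T $ k" if k: "k < N'" for k
      proof (cases "k \<in> ?J")
        case True
        then have "k \<in> j ` {..<?K}" unfolding bij_betw_imp_surj_on[OF j] .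
        then obtain l where "l < ?K" "j l = k" by (auto simp only: lessThan_iff)
        then show ?thesis using arg_cong[OF ST(3), of "\<lambda>x. x $ l"] by (simp add: \<phi>_def)
      qed (use support ST k in auto)
      then have "y S = y T" using y by (intro eq_vecI) (auto simp: carrier_vecD[OF y])
      then have vv: "S *\<^sub>v v = T *\<^sub>v v" using Uy[OF ST(1)] Uy[OF ST(2)] by simp
      have "S * U = T * U"
        by (rule mat_eq_on_GL_monomials[OF rn A mult_carrier_mat[OF Hc[OF ST(1)] U(1)]
          mult_carrier_mat[OF Hc[OF ST(2)] U(1)]]) (simp only: hom_orbit ST(1,2) vv)
      then show "S = T" by (rule right_cancel[OF Hc[OF ST(1)] Hc[OF ST(2)]])
    next
      fix x :: "complex vec" assume x: "x \<in> carrier_vec ?K"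
      define z where "z = vec N' (\<lambda>k. if k \<in> ?J then x $ inv_into {..<?K} j k else 0)"
      have "z \<in> carrier_vec N'" "\<And>k. k < N' \<Longrightarrow> k \<notin> ?J \<Longrightarrow> z $ k = 0" by (auto simp: z_def)
      then obtain T where T: "T \<in> ?H" "y T = z" using ex_hom by blast
      have "z $ j l = x $ l" if l: "l < ?K" for l
      proof -
        have "inv_into {..<?K} j (j l) = l" using j l by (auto simp: bij_betw_def inv_into_f_f)
        then show ?thesis using j_less[OF l] by (auto simp: z_def)
      qed
      then have "\<phi> T = x" using T x by (intro eq_vecI) (auto simp: \<phi>_def)
      then show "x \<in> \<phi> ` ?H" using T by blast
    qed (auto simp: \<phi>_def)
  qed
  also have "?K = card (weight_exponents n r s a b)"
  proof (rule bij_betw_same_card)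
    have "B ` ?J = weight_exponents n r s a b"
    proof
      show "weight_exponents n r s a b \<subseteq> B ` ?J"
      proof
        fix m assume m: "m \<in> weight_exponents n r s a b"
        then have "m \<in> B ` {..<N'}" using B by (auto simp: bij_betw_def weight_exponents_def)
        then show "m \<in> B ` ?J" using m by auto
      qed
    qed auto
    then show "bij_betw B ?J (weight_exponents n r s a b)"
      using B inj_on_subset[of B "{..<N'}" ?J] by (auto simp: bij_betw_def)
  qed
  finally show ?thesis by (simp add: dim_Hom_GL_def)
qed

theorem corollary6:
  fixes n r s :: nat
    and a b d e :: "nat \<Rightarrow> nat"
    and \<rho> \<sigma> :: "nat \<Rightarrow> complex mat \<Rightarrow> complex mat"
  assumes "r \<ge> 1" and "s \<ge> 1" and "n \<ge> r + s"
    and "\<And>i. i < r \<Longrightarrow> F_rep n (a i) (d i) (\<rho> i)"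
    and "\<And>j. j < s \<Longrightarrow> F_rep n (b j) (e j) (\<sigma> j)"
  shows "dim_Hom_GL n (\<Prod>i<r. d i) (tensor_rep r \<rho>) (\<Prod>j<s. e j) (tensor_rep s \<sigma>)
       = card (contingency_tables r s a b)"
proof -
  have rn: "r \<le> n" and sn: "s \<le> n" and n: "n \<ge> 1" using assms(1-3) by auto
  have rep: "\<And>i. i < r \<Longrightarrow> GL_rep n (d i) (\<rho> i)" "\<And>j. j < s \<Longrightarrow> GL_rep n (e j) (\<sigma> j)"
    using assms(4,5) by (auto simp: F_rep_def irreducible_rep_def)
  have pf: "poly_fun n (\<lambda>g. tensor_rep s \<sigma> g $$ (k, l))" if "k < (\<Prod>j<s. e j)" "l < (\<Prod>j<s. e j)" for k l
    using that assms(5) rep(2)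
    by (intro tensor_rep_poly_fun polynomial_function_poly_fun) (auto simp: F_rep_def polynomial_rep_def)
  have T: "GL_rep n (\<Prod>i<r. d i) (tensor_rep r \<rho>)" "GL_rep n (\<Prod>j<s. e j) (tensor_rep s \<sigma>)"
    using rep by (auto intro: tensor_rep_GL_rep)
  obtain N A U L where M: "monomial_model n r a (\<Prod>i<r. d i) (tensor_rep r \<rho>) N A U L"
    using tensor_rep_monomial_model[of r n a d \<rho>, OF assms(4) n] by blast
  obtain N' B U' L' where M': "monomial_model n s b (\<Prod>j<s. e j) (tensor_rep s \<sigma>) N' B U' L'"
    using tensor_rep_monomial_model[of s n b e \<sigma>, OF assms(5) n] by blast
  have "dim_Hom_GL n (\<Prod>i<r. d i) (tensor_rep r \<rho>) (\<Prod>j<s. e j) (tensor_rep s \<sigma>)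
      = card (weight_exponents n r s a b)"
    by (rule dim_Hom_GL_monomial_models[OF rn sn T pf M M'])
  then show ?thesis using card_weight_exponents[OF rn] by simp
qed

end
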